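(* Let $n\in\mathbb{N}_0$, $\mu\in(-1/2,\infty)\setminus\{0\}$, $\lambda\in\mathbb{C}$, $\rho\in\mathbf{D}$. With $R=\sqrt{1+\rho^2-2\rho x}$, $$\int_{-1}^1(1-x^2)^{\mu/2-1/4}\,P_{\mu-1/2-\lambda}^{1/2-\mu}(R+\rho)\,\mathrm{P}_{\mu-1/2-\lambda}^{1/2-\mu}(R-\rho)\,C_n^\mu(x)\,dx=\frac{(\lambda)_n\,(2\mu-\lambda)_n\,\rho^{n+\mu-1/2}\,2^{\mu-1/2}}{(n+\mu)\,\Gamma(2\mu)\,(\mu+\frac12)_n\,n!}.$$
   Context: $\mathbb{N}_0=\{0,1,2,\dots\}$, $\mathbf{D}=\{z\in\mathbb{C}:|z|<1\}$. $(z)_n=\prod_{i=1}^n(z+i-1)$ is the Pochhammer symbol. ${}_2F_1$ is the Gauss hypergeometric function, analytically continued to $\mathbb{C}\setminus[1,\infty)$. The Gegenbauer polynomials are $C_n^\mu(z)=\frac{(2\mu)_n}{n!}\,{}_2F_1(-n,n+2\mu;\mu+\frac12;\frac{1-z}{2})$. The associated Legendre function of the first kind (italic $P$) on $\mathbb{C}\setminus(-\infty,1]$ is $P_\nu^\mu(z)=\frac{1}{\Gamma(1-\mu)}\left(\frac{z+1}{z-1}\right)^{\mu/2}{}_2F_1(-\nu,\nu+1;1-\mu;\frac{1-z}{2})$, and the Ferrers function of the first kind (roman $\mathrm{P}$) on $(-1,1)$ is $\mathrm{P}_\nu^\mu(x)=\frac{1}{\Gamma(1-\mu)}\left(\frac{1+x}{1-x}\right)^{\mu/2}{}_2F_1(-\nu,\nu+1;1-\mu;\frac{1-x}{2})$.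 Convention: for $\rho\in(0,1)$ the identity is literal; for general $\rho\in\mathbf{D}$ it is understood by analytic continuation, namely: for each fixed $x\in(-1,1)$ the function $\rho\mapsto\rho^{1/2-\mu}P_{\mu-1/2-\lambda}^{1/2-\mu}(R+\rho)\,\mathrm{P}_{\mu-1/2-\lambda}^{1/2-\mu}(R-\rho)$ on $(0,1)$ extends analytically to $\mathbf{D}$, and the identity holds on $\mathbf{D}$ after both sides are multiplied by $\rho^{1/2-\mu}$ (with this extension used in the integrand). *)

theory Defs
  imports "HOL-Complex_Analysis.Complex_Analysis"
begin

definition cut_plane :: "complex set" where
  "cut_plane = - complex_of_real ` {1..}"

definition hyp2F1_term :: "complex \<Rightarrow> complex \<Rightarrow> complex \<Rightarrow> complex \<Rightarrow> nat \<Rightarrow> complex" where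
  "hyp2F1_term a b c z k =
     pochhammer a k * pochhammer b k / (pochhammer c k * fact k) * z ^ k"

(* A terminating series is a polynomial and is used on the whole plane, so that Gegenbauer
   polynomials are polynomials also on the cut.  In all other cases, outside the unit disc the
   value is that of the analytic continuation to the cut plane, which is unique because the
   cut plane is connected (see hyp2F1_eqI).  The value is unspecified for z on the cut
   (non-terminating case), and only c \<notin> \<int>\<^sub>\<le>\<^sub>0 is meaningful. *)
definition hyp2F1 :: "complex \<Rightarrow> complex \<Rightarrow> complex \<Rightarrow> complex \<Rightarrow> complex" where
  "hyp2F1 a b c z =
     (if norm z < 1 \<or> a \<in> \<int>\<^sub>\<le>\<^sub>0 \<or> b \<in> \<int>\<^sub>\<le>\<^sub>0 then (\<Sum>k. hyp2F1_term a b c z k)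
      else (THE w. \<exists>f. f holomorphic_on cut_plane \<and>
                       (\<forall>u\<in>ball 0 1. f u = (\<Sum>k. hyp2F1_term a b c u k)) \<and> w = f z))"

definition gegenbauer :: "nat \<Rightarrow> complex \<Rightarrow> complex \<Rightarrow> complex" where
  "gegenbauer n \<mu> z =
     pochhammer (2 * \<mu>) n / fact n *
     hyp2F1 (- of_nat n) (of_nat n + 2 * \<mu>) (\<mu> + 1 / 2) ((1 - z) / 2)"

definition legendre_P :: "complex \<Rightarrow> complex \<Rightarrow> complex \<Rightarrow> complex" where
  "legendre_P \<nu> \<mu> z =
     1 / Gamma (1 - \<mu>) * ((z + 1) / (z - 1)) powr (\<mu> / 2) *
     hyp2F1 (- \<nu>) (\<nu> + 1) (1 - \<mu>) ((1 - z) / 2)"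

definition ferrers_P :: "complex \<Rightarrow> complex \<Rightarrow> real \<Rightarrow> complex" where
  "ferrers_P \<nu> \<mu> x =
     1 / Gamma (1 - \<mu>) * complex_of_real ((1 + x) / (1 - x)) powr (\<mu> / 2) *
     hyp2F1 (- \<nu>) (\<nu> + 1) (1 - \<mu>) (complex_of_real ((1 - x) / 2))"

definition legendre_ferrers :: "real \<Rightarrow> complex \<Rightarrow> real \<Rightarrow> real \<Rightarrow> complex" where
  "legendre_ferrers \<mu> l \<rho> x =
     (let R = sqrt (1 + \<rho>\<^sup>2 - 2 * \<rho> * x);
          \<nu> = complex_of_real (\<mu> - 1 / 2) - l;
          \<kappa> = complex_of_real (1 / 2 - \<mu>)
      in legendre_P \<nu> \<kappa> (complex_of_real (R + \<rho>)) * ferrers_P \<nu> \<kappa> (R - \<rho>))"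

lemma open_cut_plane: "open cut_plane"
proof -
  have "closed (complex_of_real ` {1..})"
    by (rule closed_injective_linear_image) (auto simp: linear_of_real inj_def)
  thus ?thesis by (simp add: cut_plane_def open_closed)
qed

lemma connected_cut_plane: "connected cut_plane"
proof (rule starlike_imp_connected)
  have "t *\<^sub>R z \<in> cut_plane" if "z \<in> cut_plane" "0 \<le> t" "t \<le> 1" for t z
  proof (cases "t = 0")
    case False
    show ?thesis
    proof (rule ccontr)
      assume "t *\<^sub>R z \<notin> cut_plane"
      then obtain r where r: "1 \<le> r" "t *\<^sub>R z = of_real r" by (auto simp: cut_plane_def)
      hence "z = of_real (r / t)" using False by (simp add: scaleR_conv_of_real field_simps)
      moreover have "1 \<le> r / t" using r that False by (simp add: field_simps)
      ultimately show False using that(1) unfolding cut_plane_def by blast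
    qed
  qed (auto simp: cut_plane_def)
  moreover have "0 \<in> cut_plane" by (auto simp: cut_plane_def)
  ultimately show "starlike cut_plane"
    unfolding starlike_def closed_segment_def by (intro bexI[of _ 0]) auto
qed

lemma ball_subset_cut_plane: "ball 0 1 \<subseteq> cut_plane"
  by (auto simp: cut_plane_def)

lemma hyp2F1_continuation_unique:
  assumes "f holomorphic_on cut_plane" "g holomorphic_on cut_plane"
    and "\<And>u. u \<in> ball 0 1 \<Longrightarrow> f u = g u" and "z \<in> cut_plane"
  shows "f z = g z"
  by (rule analytic_continuation_open[of "ball 0 1" cut_plane])
     (use assms open_cut_plane connected_cut_plane ball_subset_cut_plane in auto)

lemma hyp2F1_terminating_sum:
  assumes "a \<in> \<int>\<^sub>\<le>\<^sub>0 \<or> b \<in> \<int>\<^sub>\<le>\<^sub>0"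
  shows "\<exists>N. \<forall>z. (\<Sum>k. hyp2F1_term a b c z k) = (\<Sum>k<N. hyp2F1_term a b c z k)"
proof -
  obtain m where m: "a = - of_nat m \<or> b = - of_nat m"
    using assms by (auto elim!: nonpos_Ints_cases')
  have "hyp2F1_term a b c z k = 0" if "k \<notin> {..<Suc m}" for z k
    using m that by (auto simp: hyp2F1_term_def pochhammer_eq_0_iff)
  thus ?thesis by (intro exI[of _ "Suc m"] allI suminf_finite) auto
qed

lemma hyp2F1_eqI:
  assumes f: "f holomorphic_on cut_plane"
    and eq: "\<And>u. u \<in> ball 0 1 \<Longrightarrow> f u = (\<Sum>k. hyp2F1_term a b c u k)"
    and z: "z \<in> cut_plane"
  shows "hyp2F1 a b c z = f z"
proof (cases "a \<in> \<int>\<^sub>\<le>\<^sub>0 \<or> b \<in> \<int>\<^sub>\<le>\<^sub>0")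
  case True
  then obtain N where
    N: "\<And>u. (\<Sum>k. hyp2F1_term a b c u k) = (\<Sum>k<N. hyp2F1_term a b c u k)"
    using hyp2F1_terminating_sum by blast
  have "(\<lambda>u. \<Sum>k<N. hyp2F1_term a b c u k) holomorphic_on cut_plane"
    unfolding hyp2F1_term_def by (intro holomorphic_intros)
  hence "f z = (\<Sum>k<N. hyp2F1_term a b c z k)"
    by (rule hyp2F1_continuation_unique[OF f]) (use eq N z in auto)
  thus ?thesis using True N by (auto simp: hyp2F1_def)
next
  case False
  show ?thesis
  proof (cases "norm z < 1")
    case True
    thus ?thesis using eq[of z] by (simp add: hyp2F1_def)
  next
    case nz: False
    have "(THE w. \<exists>f. f holomorphic_on cut_plane \<and>
            (\<forall>u\<in>ball 0 1. f u = (\<Sum>k. hyp2F1_term a b c u k)) \<and> w = f z) = f z"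
    proof (rule the_equality)
      fix w
      assume "\<exists>g. g holomorphic_on cut_plane \<and>
            (\<forall>u\<in>ball 0 1. g u = (\<Sum>k. hyp2F1_term a b c u k)) \<and> w = g z"
      then obtain g where g: "g holomorphic_on cut_plane" "w = g z"
        "\<forall>u\<in>ball 0 1. g u = (\<Sum>k. hyp2F1_term a b c u k)" by blast
      show "w = f z"
        unfolding g(2) by (rule hyp2F1_continuation_unique[OF g(1) f]) (use eq g z in auto)
    qed (use f eq in blast)
    thus ?thesis using False nz by (simp add: hyp2F1_def)
  qed
qed

end

theory Submission
  imports Defs
begin

text \<open>
  The product of the two Legendre functions is a generating function of Gegenbauer polynomials, and the
  integral extracts one of its coefficients.

  Write \<open>c = \<mu> + 1/2\<close>. The Euler transformation (\<open>hyp2F1_Euler\<close>) turns the two hypergeometric factors into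
  \<open>F(\<lambda>, 2\<mu> - \<lambda>; c; u)\<close> and \<open>F(\<lambda>, 2\<mu> - \<lambda>; c; v)\<close> with \<open>u = (1 - R - \<rho>) / 2\<close>, \<open>v = (1 - R + \<rho>) / 2\<close>, and the
  algebraic prefactors collapse to \<open>\<rho> / 2\<close> to the power \<open>\<mu> - 1/2\<close> times \<open>1 - x^2\<close> to the power
  \<open>\<mu>/2 - 1/4\<close> (\<open>legendre_prefactor\<close>). Brafman's formula (\<open>Brafman\<close>, \<open>brafman_nth\<close>) expands the product of
  the hypergeometric functions as
    \<open>\<Sum>n. (\<lambda>)_n (2\<mu> - \<lambda>)_n / ((c)_n (2\<mu>)_n) C_n(x) \<rho>^n\<close>.
  The weight in the integral and the prefactor give together the Gegenbauer weight, so orthogonality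
  (\<open>ultra_orthogonal\<close>) leaves the \<open>n\<close>-th term. The series also provides the analytic extension in \<open>\<rho>\<close>.

  Brafman's formula comes from Bailey's factorization (\<open>Bailey_local\<close>): with \<open>s = X (1 - Y)\<close> and
  \<open>t = Y (1 - X)\<close>, the Appell series \<open>F_4(s, t)\<close> equals \<open>F(X) F(Y)\<close>. As a function of \<open>X\<close> each homogeneous part
  of \<open>F_4\<close> is mapped by the hypergeometric operator to a difference that telescopes over the degree
  (\<open>hyp_ode_f4_partial\<close>); hence \<open>F_4\<close> solves the equation of \<open>F(X)\<close>, whose power series solution is unique
  up to a factor. At \<open>X = u\<close>, \<open>Y = v\<close> the part of degree \<open>n\<close> is \<open>\<rho>^n\<close> times a form in \<open>x - 1\<close> and \<open>x + 1\<close>,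
  and this form is a multiple of the Gegenbauer polynomial (\<open>ultra_eq_jacobi_form\<close>). Bailey's argument
  works for small \<open>\<rho>\<close> only; analytic continuation carries the formula to \<open>0 < \<rho> < 1\<close>.

  Convergence in the whole disc and integration term by term both rest on a bound for \<open>C_n\<close> on \<open>[-1, 1]\<close>
  of subexponential growth (\<open>abs_ultra_le\<close>), which is read off from the trigonometric form of the
  generating function.
\<close>

unbundle no vec_syntax

section \<open>Hypergeometric series and the Euler transformation\<close>

lemma summable_ratio_limit_one:
  fixes f :: "nat \<Rightarrow> complex"
  assumes ratio: "\<And>n. norm (f (Suc n)) \<le> q n * norm (f n)"
    and q: "q \<longlonglongrightarrow> 1" and r: "0 \<le> r" "r < 1"
  shows "summable (\<lambda>n. norm (f n) * r ^ n)"
proof (cases "r = 0")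
  case True
  have "(\<lambda>n. norm (f n) * r ^ n) = (\<lambda>n. if n = 0 then norm (f 0) else 0)"
    using True by (auto simp: fun_eq_iff power_0_left)
  thus ?thesis by simp
next
  case False
  hence "0 < r" using r by simp
  obtain c where c: "r < c" "c < 1" using r dense by blast
  have "1 < c / r" using c \<open>0 < r\<close> by simp
  hence "eventually (\<lambda>n. q n < c / r) sequentially" by (rule order_tendstoD(2)[OF q])
  then obtain N where N: "\<And>n. n \<ge> N \<Longrightarrow> q n < c / r" by (auto simp: eventually_sequentially)
  show ?thesis
  proof (rule summable_ratio_test[OF c(2)])
    fix n assume "N \<le> n"
    have "norm (f (Suc n)) * r ^ Suc n \<le> (q n * norm (f n)) * r ^ Suc n"
      using ratio r by (intro mult_right_mono) auto
    also have "\<dots> \<le> (c / r * norm (f n)) * r ^ Suc n"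
      using N[OF \<open>N \<le> n\<close>] r by (intro mult_right_mono) auto
    also have "\<dots> = c * (norm (f n) * r ^ n)" using \<open>0 < r\<close> by simp
    finally show "norm (norm (f (Suc n)) * r ^ Suc n) \<le> c * norm (norm (f n) * r ^ n)"
      using r by (simp add: abs_mult)
  qed
qed

lemma norm_ratio_tendsto_1:
  fixes a c :: complex
  shows "(\<lambda>n. norm ((a + of_nat n) / (c + of_nat n))) \<longlonglongrightarrow> 1"
proof -
  have "(\<lambda>n. (a + of_nat n) / (c + of_nat n)) \<longlonglongrightarrow> 1"
  proof -
    have i: "(\<lambda>n. inverse (of_nat n :: complex)) \<longlonglongrightarrow> 0"
      by (rule lim_inverse_n)
    have "(\<lambda>n. (a * inverse (of_nat n) + 1) / (c * inverse (of_nat n) + 1)) \<longlonglongrightarrow> (a * 0 + 1) / (c * 0 + 1)"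
      by (intro tendsto_intros i) auto
    moreover have "eventually (\<lambda>n. (a * inverse (of_nat n) + 1) / (c * inverse (of_nat n) + 1)
        = (a + of_nat n) / (c + of_nat n)) sequentially"
      using eventually_gt_at_top[of 0]
    proof eventually_elim
      case (elim n)
      have "(a * inverse (of_nat n) + 1) = (a + of_nat n) * inverse (of_nat n)"
        "(c * inverse (of_nat n) + 1) = (c + of_nat n) * inverse (of_nat n)"
        using elim by (simp_all add: field_simps)
      thus ?case using elim by simp
    qed
    ultimately show ?thesis by (simp add: Lim_transform_eventually)
  qed
  from tendsto_norm[OF this] show ?thesis by simp
qed

lemma Re_pos_add_nat_neq_0: "Re c > 0 \<Longrightarrow> c + of_nat n \<noteq> 0"
  by (auto simp: complex_eq_iff)

definition hyp_fps :: "complex \<Rightarrow> complex \<Rightarrow> complex \<Rightarrow> complex fps" where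
  "hyp_fps a b c = Abs_fps (\<lambda>k. pochhammer a k * pochhammer b k / (pochhammer c k * fact k))"

lemma hyp_fps_Suc:
  "hyp_fps a b c $ Suc k =
     ((a + of_nat k) / (c + of_nat k)) * ((b + of_nat k) / (1 + of_nat k)) * hyp_fps a b c $ k"
  by (simp add: hyp_fps_def pochhammer_Suc field_simps)

lemma fps_conv_radius_hyp_fps: "fps_conv_radius (hyp_fps a b c) \<ge> 1"
proof -
  have q: "(\<lambda>k. norm ((a + of_nat k) / (c + of_nat k)) * norm ((b + of_nat k) / (1 + of_nat k))) \<longlonglongrightarrow> 1"
    using tendsto_mult[OF norm_ratio_tendsto_1[of a c] norm_ratio_tendsto_1[of b 1]] by simp
  have "summable (\<lambda>k. norm (hyp_fps a b c $ k * of_real r ^ k))" if "0 \<le> r" "r < 1" for r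
    using summable_ratio_limit_one[OF _ q that, of "fps_nth (hyp_fps a b c)"] that
    by (simp add: hyp_fps_Suc norm_mult norm_divide norm_power)
  hence "conv_radius (fps_nth (hyp_fps a b c)) \<ge> 1"
    by (intro conv_radius_geI_ex') (auto intro: summable_norm_cancel)
  thus ?thesis by (simp add: fps_conv_radius_def)
qed

lemma eval_hyp_fps: "eval_fps (hyp_fps a b c) z = (\<Sum>k. hyp2F1_term a b c z k)"
  by (simp add: eval_fps_def hyp_fps_def hyp2F1_term_def)

lemma hyp2F1_eval_fps: "norm z < 1 \<Longrightarrow> hyp2F1 a b c z = eval_fps (hyp_fps a b c) z"
  by (simp add: eval_hyp_fps hyp2F1_def)

text \<open>
  The hypergeometric operator
  \<open>z (1 - z) F'' + (c - (a + b + 1) z) F' - a b F\<close>, applied to formal series: its kernel can then be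
  read off coefficientwise, with no question of convergence.
\<close>

definition hyp_ode :: "complex \<Rightarrow> complex \<Rightarrow> complex \<Rightarrow> complex fps \<Rightarrow> complex fps" where
  "hyp_ode a b c F = fps_X * fps_deriv (fps_deriv F) - fps_X * (fps_X * fps_deriv (fps_deriv F))
     + fps_const c * fps_deriv F - fps_const (a + b + 1) * (fps_X * fps_deriv F)
     - fps_const (a * b) * F"

lemma hyp_ode_nth:
  "hyp_ode a b c F $ n = of_nat (Suc n) * (c + of_nat n) * F $ Suc n
      - (a + of_nat n) * (b + of_nat n) * F $ n"
proof (cases n)
  case (Suc m)
  thus ?thesis by (cases m) (simp_all add: hyp_ode_def algebra_simps)
qed (simp add: hyp_ode_def algebra_simps)

text \<open>
  The indicial exponents at \<open>0\<close> are \<open>0\<close> and \<open>1 - c\<close>; since \<open>Re c > 0\<close>, the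
  recurrence never degenerates and a power series solution is fixed by its constant term. This is the
  uniqueness principle behind both the Euler transformation and the product formula.
\<close>

lemma hyp_recurrence_unique:
  fixes f :: "nat \<Rightarrow> complex"
  assumes c: "Re c > 0"
    and rec: "\<And>n. of_nat (Suc n) * (c + of_nat n) * f (Suc n) = (a + of_nat n) * (b + of_nat n) * f n"
  shows "f n = f 0 * hyp_fps a b c $ n"
proof (induction n)
  case (Suc n)
  have nz: "of_nat (Suc n) \<noteq> (0::complex)" by (rule of_nat_neq_0)
  have "f (Suc n) = (a + of_nat n) * (b + of_nat n) * f n / (of_nat (Suc n) * (c + of_nat n))"
    using rec[of n] Re_pos_add_nat_neq_0[OF c, of n] nz
    by (simp add: eq_divide_eq mult_ac del: of_nat_Suc)
  thus ?case unfolding Suc.IH hyp_fps_Suc by (simp add: mult_ac)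
qed (simp add: hyp_fps_def)

lemma hyp_ode_hyp_fps:
  assumes "Re c > 0" shows "hyp_ode a b c (hyp_fps a b c) = 0"
proof (rule fps_ext)
  fix n
  have nz: "c + of_nat n \<noteq> 0" "of_nat (Suc n) \<noteq> (0::complex)"
    by (rule Re_pos_add_nat_neq_0[OF assms], rule of_nat_neq_0)
  have "N * p * (A / p * (B / N) * h) = A * B * h" if "N \<noteq> 0" "p \<noteq> 0" for N p A B h :: complex
    using that by simp
  from this[OF nz(2,1)] show "hyp_ode a b c (hyp_fps a b c) $ n = 0 $ n"
    unfolding hyp_ode_nth hyp_fps_Suc by (simp only: of_nat_Suc fps_zero_nth diff_self)
qed

lemma hyp_ode_unique:
  assumes "Re c > 0" "hyp_ode a b c F = 0"
  shows "F = fps_const (F $ 0) * hyp_fps a b c"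
proof (rule fps_ext)
  fix n
  have r: "of_nat (Suc m) * (c + of_nat m) * F $ Suc m = (a + of_nat m) * (b + of_nat m) * F $ m" for m
  proof -
    have "of_nat (Suc m) * (c + of_nat m) * F $ Suc m - (a + of_nat m) * (b + of_nat m) * F $ m = 0"
      unfolding hyp_ode_nth[symmetric] assms(2) by (rule fps_zero_nth)
    thus ?thesis by (rule iffD1[OF right_minus_eq])
  qed
  show "F $ n = (fps_const (F $ 0) * hyp_fps a b c) $ n"
    unfolding fps_mult_left_const_nth
    by (rule hyp_recurrence_unique[where f = "fps_nth F" and a = a and b = b, OF assms(1)]) (rule r)
qed

definition one_minus_pow_fps :: "complex \<Rightarrow> complex fps" where
  "one_minus_pow_fps d = Abs_fps (\<lambda>k. (d gchoose k) * (- 1) ^ k)"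

lemma one_minus_pow_fps_ode:
  "(1 - fps_X) * fps_deriv (one_minus_pow_fps d) = - fps_const d * one_minus_pow_fps d"
proof (rule fps_ext)
  fix n
  have "((1 - fps_X) * fps_deriv (one_minus_pow_fps d)) $ n =
    of_nat (Suc n) * one_minus_pow_fps d $ Suc n - of_nat n * one_minus_pow_fps d $ n"
    by (cases n) (simp_all add: algebra_simps)
  also have "\<dots> = - (d * one_minus_pow_fps d $ n)"
  proof -
    have "of_nat (Suc n) * (d gchoose Suc n) = (d - of_nat n) * (d gchoose n)"
      using gbinomial_mult_1[of d n] by (simp add: algebra_simps)
    hence "of_nat (Suc n) * one_minus_pow_fps d $ Suc n = - ((d - of_nat n) * one_minus_pow_fps d $ n)"
      by (simp add: one_minus_pow_fps_def del: of_nat_Suc)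
    thus ?thesis by (simp add: algebra_simps)
  qed
  finally show "((1 - fps_X) * fps_deriv (one_minus_pow_fps d)) $ n = (- fps_const d * one_minus_pow_fps d) $ n"
    by simp
qed


text \<open>
  With \<open>d = c - a - b\<close>, the product \<open>f = (1 - X)^d F(c - a, c - b; c; X)\<close> solves the hypergeometric
  equation with parameters \<open>a, b, c\<close>: conjugation by \<open>(1 - X)^d\<close> exchanges the two exponents at \<open>1\<close>.
  All identities are multiplied by powers of \<open>w = 1 - X\<close>, which may be cancelled at the end because
  formal power series form an integral domain.
\<close>

lemma hyp_fps_Euler:
  assumes c: "Re c > 0"
  shows "hyp_fps a b c = one_minus_pow_fps (c - a - b) * hyp_fps (c - a) (c - b) c"
proof -
  define d where "d = c - a - b"
  define B where "B = one_minus_pow_fps d"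
  define H where "H = hyp_fps (c - a) (c - b) c"
  define w :: "complex fps" where "w = 1 - fps_X"
  define D where "D = fps_const d"
  define f where "f = B * H"
  have w': "fps_deriv w = -1" by (simp add: w_def)
  have D': "fps_deriv D = 0" by (simp add: D_def)
  have B1: "w * fps_deriv B = - D * B"
    using one_minus_pow_fps_ode[of d] by (simp add: B_def w_def D_def)
  have f1: "w * fps_deriv f = B * (w * fps_deriv H - D * H)"
  proof -
    have "w * fps_deriv f = (w * fps_deriv B) * H + B * (w * fps_deriv H)"
      by (simp add: f_def algebra_simps)
    thus ?thesis unfolding B1 by (simp add: algebra_simps)
  qed
  have f2: "w * (w * fps_deriv (fps_deriv f)) =
      B * (w * (w * fps_deriv (fps_deriv H)) - 2 * D * (w * fps_deriv H) + D * (D - 1) * H)"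
  proof -
    have "w * (w * fps_deriv (fps_deriv f)) - w * fps_deriv f = w * fps_deriv (w * fps_deriv f)"
      by (simp add: w' algebra_simps)
    also have "\<dots> = (w * fps_deriv B) * (w * fps_deriv H - D * H)
        + B * (w * (w * fps_deriv (fps_deriv H)) - w * fps_deriv H - D * (w * fps_deriv H))"
      unfolding f1 by (simp add: w' D' algebra_simps)
    finally show ?thesis unfolding B1 f1 by (simp add: algebra_simps)
  qed
  have Hode: "hyp_ode (c - a) (c - b) c H = 0" unfolding H_def by (rule hyp_ode_hyp_fps[OF c])
  define A' where "A' = fps_const a"
  define B' where "B' = fps_const b"
  have cc: "fps_const c = D + A' + B'" "fps_const (a + b + 1) = A' + B' + 1" "fps_const (a * b) = A' * B'"
    by (simp_all add: D_def A'_def B'_def d_def fps_const_add[symmetric] fps_const_mult[symmetric]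
        del: fps_const_add fps_const_mult)
  have cc': "fps_const ((c - a) + (c - b) + 1) = 2 * D + A' + B' + 1"
      "fps_const ((c - a) * (c - b)) = (D + A') * (D + B')"
  proof -
    have e: "(c - a) + (c - b) + 1 = d + d + a + b + 1" "(c - a) * (c - b) = (d + b) * (d + a)"
      by (simp_all add: d_def)
    show "fps_const ((c - a) + (c - b) + 1) = 2 * D + A' + B' + 1"
      unfolding e by (simp add: D_def A'_def B'_def fps_const_add[symmetric] del: fps_const_add)
    show "fps_const ((c - a) * (c - b)) = (D + A') * (D + B')"
      unfolding e by (simp add: D_def A'_def B'_def fps_const_add[symmetric] fps_const_mult[symmetric]
         mult.commute del: fps_const_add fps_const_mult)
  qed
  have f0: "w * f = w * (B * H)" by (simp add: f_def)
  have X: "fps_X = 1 - w" by (simp add: w_def)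
  have "w * hyp_ode a b c f = fps_X * (w * (w * fps_deriv (fps_deriv f)))
      + (fps_const c - fps_const (a + b + 1) * fps_X) * (w * fps_deriv f) - fps_const (a * b) * (w * f)"
    unfolding hyp_ode_def by (simp add: w_def algebra_simps)
  also have "\<dots> = B * w * hyp_ode (c - a) (c - b) c H"
    unfolding hyp_ode_def cc cc' f1 f2 f0 X by (simp add: algebra_simps)
  finally have "w * hyp_ode a b c f = 0" by (simp add: Hode)
  moreover have "w \<noteq> 0"
    by (auto simp: w_def fps_eq_iff intro!: exI[of _ 0])
  ultimately have "hyp_ode a b c f = 0" by simp
  from hyp_ode_unique[OF c this] have "f = fps_const (f $ 0) * hyp_fps a b c" .
  moreover have f0: "f $ 0 = 1" by (simp add: f_def B_def H_def one_minus_pow_fps_def hyp_fps_def)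
  ultimately have "f = hyp_fps a b c" by (metis fps_const_1_eq_1 mult_1)
  thus ?thesis by (simp add: f_def B_def H_def d_def)
qed

lemma one_minus_pow_fps_sums:
  assumes "norm z < 1"
  shows "(\<lambda>n. one_minus_pow_fps d $ n * z ^ n) sums (1 - z) powr d"
proof -
  have "(\<lambda>n. (d gchoose n) * (- z) ^ n) sums (1 + (- z)) powr d"
    using assms by (intro gen_binomial_complex) simp
  thus ?thesis by (simp add: one_minus_pow_fps_def power_minus[of z] mult_ac)
qed

lemma fps_conv_radius_one_minus_pow: "fps_conv_radius (one_minus_pow_fps d) \<ge> 1"
  unfolding fps_conv_radius_def
  by (intro conv_radius_geI_ex') (use one_minus_pow_fps_sums[of _ d] in \<open>auto simp: sums_iff\<close>)

text \<open>
  Both Legendre factors have the form \<open>F(c - a, c - b; c; z)\<close> with \<open>c - a - b\<close> equal to \<open>1/2 - \<mu>\<close>;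
  this turns them into the factors \<open>F(a, b; c; z)\<close> of the product formula.
\<close>

lemma hyp2F1_Euler:
  assumes c: "Re c > 0" and z: "norm z < 1"
  shows "hyp2F1 a b c z = (1 - z) powr (c - a - b) * hyp2F1 (c - a) (c - b) c z"
proof -
  have z': "ereal (norm z) < 1" using z by simp
  have r: "ereal (norm z) < fps_conv_radius (hyp_fps a' b' c')" for a' b' c'
    by (rule less_le_trans[OF z' fps_conv_radius_hyp_fps])
  have r': "ereal (norm z) < fps_conv_radius (one_minus_pow_fps d)" for d
    by (rule less_le_trans[OF z' fps_conv_radius_one_minus_pow])
  have e: "eval_fps (one_minus_pow_fps d) z = (1 - z) powr d" for d
    using one_minus_pow_fps_sums[OF z] by (simp add: eval_fps_def sums_iff)
  show ?thesis
    by (simp only: hyp2F1_eval_fps[OF z] hyp_fps_Euler[OF c, of a b] eval_fps_mult[OF r' r] e)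
qed

section \<open>Bailey's factorization of the Appell series\<close>

text \<open>
  \<open>f4_form c c' n\<close> is the homogeneous part of degree \<open>n\<close> of the Appell series
  \<open>F_4(a, b; c, c'; s, t)\<close>, without its factor \<open>(a)_n (b)_n\<close>.
\<close>

definition f4_coeff :: "complex \<Rightarrow> nat \<Rightarrow> complex" where
  "f4_coeff c k = 1 / (pochhammer c k * fact k)"

definition f4_form :: "complex \<Rightarrow> complex \<Rightarrow> nat \<Rightarrow> complex \<Rightarrow> complex \<Rightarrow> complex" where
  "f4_form c c' n s t = (\<Sum>j\<le>n. f4_coeff c j * f4_coeff c' (n - j) * s ^ j * t ^ (n - j))"

lemma f4_coeff_Suc:
  assumes "Re c > 0"
  shows "f4_coeff c (Suc k) * (of_nat (Suc k) * (of_nat k + c)) = f4_coeff c k"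
proof -
  have "c + of_nat k \<noteq> 0" by (rule Re_pos_add_nat_neq_0[OF assms])
  moreover have "of_nat (Suc k) \<noteq> (0 :: complex)" by (rule of_nat_neq_0)
  ultimately show ?thesis
    by (simp add: f4_coeff_def pochhammer_Suc add.commute[of "of_nat k" c] divide_simps del: of_nat_Suc)
qed

text \<open>
  The same form after Bailey's substitution \<open>s = X (1 - y)\<close>, \<open>t = y (1 - X)\<close>, as a series in \<open>X\<close> for
  a fixed number \<open>y\<close>.
\<close>

definition f4_fps :: "complex \<Rightarrow> complex \<Rightarrow> complex \<Rightarrow> nat \<Rightarrow> complex fps" where
  "f4_fps c c' y n = (\<Sum>j\<le>n. fps_const (f4_coeff c j * f4_coeff c' (n - j)) *
      ((fps_const (1 - y) * fps_X) ^ j * (fps_const y * (1 - fps_X)) ^ (n - j)))"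

lemma f4_has_fps_expansion:
  "(\<lambda>X. f4_form c c' n (X * (1 - y)) (y * (1 - X))) has_fps_expansion f4_fps c c' y n"
proof -
  have "(\<lambda>X. \<Sum>j\<le>n. f4_coeff c j * f4_coeff c' (n - j) * ((1 - y) * X) ^ j * (y * (1 - X)) ^ (n - j))
     has_fps_expansion f4_fps c c' y n"
    unfolding f4_fps_def mult.assoc[of "_ * _" "_ ^ _"]
    by (intro fps_expansion_intros)
  thus ?thesis by (simp add: f4_form_def mult.commute)
qed

lemma hyp_ode_add: "hyp_ode a b c (F + G) = hyp_ode a b c F + hyp_ode a b c G"
  by (simp add: hyp_ode_def algebra_simps)

lemma hyp_ode_0: "hyp_ode a b c 0 = 0"
  by (simp add: hyp_ode_def)

lemma hyp_ode_sum: "hyp_ode a b c (\<Sum>i\<in>A. F i) = (\<Sum>i\<in>A. hyp_ode a b c (F i))"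
  by (induction A rule: infinite_finite_induct) (simp_all add: hyp_ode_add hyp_ode_0)

lemma hyp_ode_cmult: "hyp_ode a b c (fps_const k * F) = fps_const k * hyp_ode a b c F"
  by (simp add: hyp_ode_def algebra_simps)

text \<open>
  Since \<open>s\<close> and \<open>t\<close> are linear in \<open>X\<close>, the operator lowers one exponent at a time. The condition
  \<open>c + c' = a + b + 1\<close> is exactly what makes the coefficient of \<open>s^j t^(k-1)\<close> come out as
  \<open>k (k - 1 + c')\<close>, symmetric to that of \<open>s^(j-1) t^k\<close>.
\<close>

lemma hyp_ode_monomial:
  fixes y a b c c' :: complex
  assumes cc: "c + c' = a + b + 1"
  defines "s \<equiv> fps_const (1 - y) * fps_X" and "t \<equiv> fps_const y * (1 - fps_X)"
  shows "hyp_ode a b c (s ^ j * t ^ k) =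
     fps_const (1 - y) * (fps_const (of_nat j * (of_nat j - 1 + c)) * (s ^ (j - 1) * t ^ k))
     + fps_const y * (fps_const (of_nat k * (of_nat k - 1 + c')) * (s ^ j * t ^ (k - 1)))
     - fps_const ((a + of_nat (j + k)) * (b + of_nat (j + k))) * (s ^ j * t ^ k)"
proof -
  define X :: "complex fps" where "X = fps_X"
  define p q where "p = fps_const (1 - y)" and "q = fps_const y"
  define J K :: "complex fps" where "J = of_nat j" and "K = of_nat k"
  define S T s1 s2 t1 t2 where "S = s ^ j" and "T = t ^ k"
    and "s1 = of_nat j * s ^ (j - 1)" and "s2 = of_nat j * (of_nat (j - 1) * s ^ (j - 1 - 1))"
    and "t1 = of_nat k * t ^ (k - 1)" and "t2 = of_nat k * (of_nat (k - 1) * t ^ (k - 1 - 1))"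
  define A B C C' where "A = fps_const a" and "B = fps_const b" and "C = fps_const c"
    and "C' = fps_const c'"
  have s: "s = X * p" and t: "t = (1 - X) * q"
    by (simp_all add: s_def t_def X_def p_def q_def mult.commute)
  have ds: "fps_deriv s = p" "fps_deriv t = - q" "fps_deriv p = 0" "fps_deriv q = 0"
    by (simp_all add: s_def t_def p_def q_def)
  have dS: "fps_deriv S = p * s1" "fps_deriv s1 = p * s2" "fps_deriv T = - q * t1" "fps_deriv t1 = - q * t2"
    by (simp_all add: S_def T_def s1_def s2_def t1_def t2_def fps_deriv_power' ds mult_ac)
  \<comment> \<open>Euler relations for the powers; with them all second derivatives disappear.\<close>
  have r1: "X * p * s1 = J * S"
    unfolding s1_def S_def J_def s[symmetric] by (cases j) (simp_all add: mult_ac)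
  have r2: "X * p * s2 = (J - 1) * s1"
    unfolding s1_def s2_def J_def s[symmetric]
    by (cases j; cases "j - 1") (simp_all add: mult_ac)
  have r3: "(1 - X) * q * t1 = K * T"
    unfolding t1_def T_def K_def t[symmetric] by (cases k) (simp_all add: mult_ac)
  have r4: "(1 - X) * q * t2 = (K - 1) * t1"
    unfolding t1_def t2_def K_def t[symmetric]
    by (cases k; cases "k - 1") (simp_all add: mult_ac)
  have "hyp_ode a b c (S * T) =
     (1 - X) * p * (X * p * s2) * T - 2 * (X * p * s1) * ((1 - X) * q * t1)
     + X * q * ((1 - X) * q * t2) * S + C * (p * s1 * T) - (A + B + 1) * (X * p * s1) * T
     - C * q * S * t1 + (A + B + 1) * (X * q * t1) * S - A * B * S * T"
    unfolding hyp_ode_def A_def B_def C_def X_def[symmetric]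
    by (simp add: dS ds algebra_simps flip: fps_const_add fps_const_mult)
  also have "\<dots> = (1 - X) * p * ((J - 1) * s1) * T - 2 * (J * S) * (K * T)
     + X * q * ((K - 1) * t1) * S + C * (p * s1 * T) - (A + B + 1) * (J * S) * T
     - C * q * S * t1 + (A + B + 1) * (X * q * t1) * S - A * B * S * T"
    by (simp only: r1 r2 r3 r4)
  also have "\<dots> = (J - 1) * (p * s1 - X * p * s1) * T - 2 * (J * S) * (K * T)
     + (K - 1 + A + B + 1) * (q * t1 - (1 - X) * q * t1) * S + C * (p * s1 * T) - (A + B + 1) * (J * S) * T
     - C * q * S * t1 - A * B * S * T"
    by (simp add: algebra_simps)
  also have "\<dots> = p * ((J - 1 + C) * s1 * T) + q * ((K - 1 + (A + B + 1 - C)) * S * t1)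
      - (A + (J + K)) * (B + (J + K)) * (S * T)"
    unfolding r1 r3 by (simp add: algebra_simps)
  also have "A + B + 1 - C = C'"
    using arg_cong[OF cc, of fps_const]
    by (simp add: A_def B_def C_def C'_def algebra_simps flip: fps_const_add)
  finally show ?thesis
    by (simp add: S_def T_def s1_def t1_def p_def q_def J_def K_def A_def B_def C_def C'_def fps_of_nat
       mult_ac flip: fps_const_add fps_const_mult fps_const_sub)
qed

text \<open>
  The coefficients of the form are such that lowering either exponent gives the form of degree \<open>n\<close>;
  the weights \<open>1 - y\<close> and \<open>y\<close> of the two contributions add up to \<open>1\<close>.
\<close>

lemma hyp_ode_f4_Suc:
  assumes cc: "c + c' = a + b + 1" and c: "Re c > 0" "Re c' > 0"
  shows "hyp_ode a b c (f4_fps c c' y (Suc n)) = f4_fps c c' y n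
     - fps_const ((a + of_nat (Suc n)) * (b + of_nat (Suc n))) * f4_fps c c' y (Suc n)"
proof -
  define s t where "s = fps_const (1 - y) * fps_X" and "t = fps_const y * (1 - fps_X)"
  define e f where "e = f4_coeff c" and "f = f4_coeff c'"
  have e: "e (Suc k) * (of_nat (Suc k) * (of_nat k + c)) = e k"
    and f: "f (Suc k) * (of_nat (Suc k) * (of_nat k + c')) = f k" for k
    unfolding e_def f_def by (rule f4_coeff_Suc, rule c)+
  have f4: "f4_fps c c' y m = (\<Sum>j\<le>m. fps_const (e j * f (m - j)) * (s ^ j * t ^ (m - j)))" for m
    by (simp add: f4_fps_def e_def f_def s_def t_def)
  let ?k = "fps_const ((a + of_nat (Suc n)) * (b + of_nat (Suc n)))"
  have "hyp_ode a b c (f4_fps c c' y (Suc n)) =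
     (\<Sum>j\<le>Suc n. fps_const (e j * f (Suc n - j)) * hyp_ode a b c (s ^ j * t ^ (Suc n - j)))"
    unfolding f4 by (simp only: hyp_ode_sum hyp_ode_cmult)
  also have "\<dots> = (\<Sum>j\<le>Suc n.
       fps_const (1 - y) * (fps_const (e j * f (Suc n - j) * (of_nat j * (of_nat j - 1 + c))) * (s ^ (j - 1) * t ^ (Suc n - j)))
     + fps_const y * (fps_const (e j * f (Suc n - j) * (of_nat (Suc n - j) * (of_nat (Suc n - j) - 1 + c'))) * (s ^ j * t ^ (Suc n - j - 1)))
     - ?k * (fps_const (e j * f (Suc n - j)) * (s ^ j * t ^ (Suc n - j))))"
  proof (rule sum.cong[OF refl], goal_cases)
    case (1 j)
    hence jj: "j + (Suc n - j) = Suc n" by simp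
    have dist: "E * (P * (U * V) + Q * (W * Z) - K * R) = P * ((E * U) * V) + Q * ((E * W) * Z) - K * (E * R)"
      for E P U V Q W Z K R :: "complex fps" by (simp add: algebra_simps)
    show ?case
      unfolding hyp_ode_monomial[OF cc, where y = y, folded s_def t_def] jj dist fps_const_mult ..
  qed
  also have "\<dots> = fps_const (1 - y) * (\<Sum>j\<le>Suc n. fps_const (e j * f (Suc n - j) * (of_nat j * (of_nat j - 1 + c))) * (s ^ (j - 1) * t ^ (Suc n - j)))
     + fps_const y * (\<Sum>j\<le>Suc n. fps_const (e j * f (Suc n - j) * (of_nat (Suc n - j) * (of_nat (Suc n - j) - 1 + c'))) * (s ^ j * t ^ (Suc n - j - 1)))
     - ?k * f4_fps c c' y (Suc n)"
    unfolding f4 by (simp only: sum.distrib sum_subtractf sum_distrib_left)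
  also have "(\<Sum>j\<le>Suc n. fps_const (e j * f (Suc n - j) * (of_nat j * (of_nat j - 1 + c))) * (s ^ (j - 1) * t ^ (Suc n - j)))
      = f4_fps c c' y n"
  proof -
    have "(\<Sum>j\<le>Suc n. fps_const (e j * f (Suc n - j) * (of_nat j * (of_nat j - 1 + c))) * (s ^ (j - 1) * t ^ (Suc n - j)))
      = (\<Sum>j\<le>n. fps_const ((e (Suc j) * (of_nat (Suc j) * (of_nat j + c))) * f (n - j)) * (s ^ j * t ^ (n - j)))"
      by (subst sum.atMost_Suc_shift) (simp add: mult_ac add_ac)
    thus ?thesis unfolding e f4 .
  qed
  also have "(\<Sum>j\<le>Suc n. fps_const (e j * f (Suc n - j) * (of_nat (Suc n - j) * (of_nat (Suc n - j) - 1 + c'))) * (s ^ j * t ^ (Suc n - j - 1)))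
      = f4_fps c c' y n"
  proof -
    have "(\<Sum>j\<le>Suc n. fps_const (e j * f (Suc n - j) * (of_nat (Suc n - j) * (of_nat (Suc n - j) - 1 + c'))) * (s ^ j * t ^ (Suc n - j - 1)))
      = (\<Sum>j\<le>n. fps_const (e j * (f (Suc (n - j)) * (of_nat (Suc (n - j)) * (of_nat (n - j) + c')))) * (s ^ j * t ^ (n - j)))"
      unfolding sum.atMost_Suc by (simp add: Suc_diff_le mult_ac add_ac)
    thus ?thesis unfolding f f4 .
  qed
  also have "fps_const (1 - y) * f4_fps c c' y n + fps_const y * f4_fps c c' y n = f4_fps c c' y n"
    by (simp add: algebra_simps flip: fps_const_sub)
  finally show ?thesis .
qed

definition f4_partial :: "complex \<Rightarrow> complex \<Rightarrow> complex \<Rightarrow> complex \<Rightarrow> complex \<Rightarrow> nat \<Rightarrow> complex fps" where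
  "f4_partial a b c c' y N =
     (\<Sum>n\<le>N. fps_const (pochhammer a n * pochhammer b n) * f4_fps c c' y n)"

text \<open>
  Summing the previous lemma against \<open>(a)_n (b)_n\<close> telescopes, so a partial sum of the Appell
  series fails to solve the hypergeometric equation only by a single boundary term.
\<close>

lemma hyp_ode_f4_partial:
  assumes cc: "c + c' = a + b + 1" and c: "Re c > 0" "Re c' > 0"
  shows "hyp_ode a b c (f4_partial a b c c' y N) =
    - (fps_const (pochhammer a (Suc N) * pochhammer b (Suc N)) * f4_fps c c' y N)"
proof (induction N)
  case 0
  show ?case by (simp add: f4_partial_def f4_fps_def f4_coeff_def hyp_ode_def)
next
  case (Suc N)
  have "hyp_ode a b c (f4_partial a b c c' y (Suc N)) = hyp_ode a b c (f4_partial a b c c' y N)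
     + fps_const (pochhammer a (Suc N) * pochhammer b (Suc N)) * hyp_ode a b c (f4_fps c c' y (Suc N))"
    by (simp add: f4_partial_def hyp_ode_add hyp_ode_cmult)
  also have "\<dots> = - (fps_const (pochhammer a (Suc N) * pochhammer b (Suc N)
        * ((a + of_nat (Suc N)) * (b + of_nat (Suc N)))) * f4_fps c c' y (Suc N))"
    unfolding Suc.IH hyp_ode_f4_Suc[OF assms] right_diff_distrib
    by (simp only: fps_const_mult[symmetric] mult.assoc) simp
  also have "pochhammer a (Suc N) * pochhammer b (Suc N) * ((a + of_nat (Suc N)) * (b + of_nat (Suc N)))
       = pochhammer a (Suc (Suc N)) * pochhammer b (Suc (Suc N))"
    unfolding pochhammer_Suc[of _ "Suc N"] by (simp only: mult_ac)
  finally show ?case .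
qed

lemma norm_pochhammer_le:
  fixes a :: complex
  shows "norm (pochhammer a n) \<le> fact n * (1 + norm a) ^ n"
proof (induction n)
  case (Suc n)
  have "norm (a + of_nat n) \<le> norm a + real n" by (metis norm_of_nat norm_triangle_ineq)
  also have "\<dots> \<le> real (Suc n) * (1 + norm a)" by (simp add: algebra_simps)
  finally have "norm (pochhammer a n) * norm (a + of_nat n) \<le>
     (fact n * (1 + norm a) ^ n) * (real (Suc n) * (1 + norm a))"
    by (intro mult_mono Suc) auto
  thus ?case by (simp add: pochhammer_Suc norm_mult mult_ac)
qed auto

lemma norm_pochhammer_ge:
  fixes c :: complex
  assumes "0 < m" "m \<le> 1" "m \<le> Re c"
  shows "fact n * m ^ n \<le> norm (pochhammer c n)"
proof (induction n)
  case (Suc n)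
  have "m * real n \<le> 1 * real n" using assms by (intro mult_right_mono) auto
  hence "real (Suc n) * m \<le> Re (c + of_nat n)" using assms by (simp add: algebra_simps)
  also have "\<dots> \<le> norm (c + of_nat n)" by (rule complex_Re_le_cmod)
  finally have "(fact n * m ^ n) * (real (Suc n) * m) \<le> norm (pochhammer c n) * norm (c + of_nat n)"
    using assms by (intro mult_mono Suc) auto
  thus ?case by (simp add: pochhammer_Suc norm_mult mult_ac)
qed auto

text \<open>
  A crude bound: it only has to beat \<open>(a)_n (b)_n\<close>, of size about \<open>(n!)^2\<close>, geometrically for small
  arguments. It uses \<open>|(c)_k| \<ge> m^k k!\<close> and \<open>binomial n j \<le> 2^n\<close>.
\<close>

lemma norm_f4_form_le:
  assumes m: "0 < m" "m \<le> 1" "m \<le> Re c" "m \<le> Re c'"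
  shows "norm (f4_form c c' n s t) \<le> (2 * (norm s + norm t) / m) ^ n / (fact n)\<^sup>2"
proof -
  have coeff: "norm (f4_coeff d k) \<le> (1 / m) ^ k / (fact k)\<^sup>2" if "m \<le> Re d" for d k
  proof -
    have "norm (f4_coeff d k) = 1 / (norm (pochhammer d k) * fact k)"
      by (simp add: f4_coeff_def norm_divide norm_mult)
    also have "\<dots> \<le> 1 / ((fact k * m ^ k) * fact k)"
    proof -
      have pos: "0 < fact k * m ^ k * fact k" using m by simp
      have le: "fact k * m ^ k * fact k \<le> norm (pochhammer d k) * fact k"
        by (intro mult_right_mono norm_pochhammer_ge[OF m(1,2) that]) auto
      show ?thesis by (rule frac_le[OF _ _ pos le]) auto
    qed
    finally show ?thesis using m by (simp add: field_simps power2_eq_square)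
  qed
  have "norm (f4_form c c' n s t) \<le> (\<Sum>j\<le>n. ((1 / m) ^ j / (fact j)\<^sup>2) * ((1 / m) ^ (n - j) / (fact (n - j))\<^sup>2)
      * norm s ^ j * norm t ^ (n - j))"
    unfolding f4_form_def
  proof (intro order.trans[OF norm_sum] sum_mono, goal_cases)
    case (1 j)
    show ?case
      unfolding norm_mult norm_power
      by (intro mult_right_mono mult_mono coeff m(3,4)) (use m in auto)
  qed
  also have "\<dots> \<le> (\<Sum>j\<le>n. (2 / m) ^ n / (fact n)\<^sup>2 * (real (n choose j) * norm s ^ j * norm t ^ (n - j)))"
  proof (rule sum_mono)
    fix j assume "j \<in> {..n}"
    hence j: "j \<le> n" by simp
    have "((1 / m) ^ j / (fact j)\<^sup>2) * ((1 / m) ^ (n - j) / (fact (n - j))\<^sup>2)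
       = (1 / m) ^ (j + (n - j)) / (fact j * fact (n - j))\<^sup>2"
      by (simp add: power_add power_mult_distrib field_simps)
    also have "\<dots> = (1 / m) ^ n / (fact n)\<^sup>2 * (real (n choose j))\<^sup>2"
      using j by (simp add: binomial_fact power_divide field_simps)
    also have "\<dots> \<le> (1 / m) ^ n / (fact n)\<^sup>2 * (2 ^ n * real (n choose j))"
    proof (intro mult_left_mono)
      have "real (n choose j) \<le> 2 ^ n"
        using binomial_le_pow2[of n j] by (metis of_nat_le_iff of_nat_numeral of_nat_power)
      thus "(real (n choose j))\<^sup>2 \<le> 2 ^ n * real (n choose j)"
        unfolding power2_eq_square by (intro mult_right_mono) auto
    qed (use m in auto)
    also have "\<dots> = (2 / m) ^ n / (fact n)\<^sup>2 * real (n choose j)"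
      by (simp add: power_divide)
    finally have "((1 / m) ^ j / (fact j)\<^sup>2) * ((1 / m) ^ (n - j) / (fact (n - j))\<^sup>2)
        \<le> (2 / m) ^ n / (fact n)\<^sup>2 * real (n choose j)" .
    from mult_right_mono[OF this, of "norm s ^ j * norm t ^ (n - j)"]
    show "((1 / m) ^ j / (fact j)\<^sup>2) * ((1 / m) ^ (n - j) / (fact (n - j))\<^sup>2) * norm s ^ j * norm t ^ (n - j)
       \<le> (2 / m) ^ n / (fact n)\<^sup>2 * (real (n choose j) * norm s ^ j * norm t ^ (n - j))"
      by (simp add: mult_ac)
  qed
  also have "\<dots> = (2 / m) ^ n / (fact n)\<^sup>2 * (norm s + norm t) ^ n"
    by (subst binomial_ring) (simp add: sum_distrib_left)
  also have "\<dots> = (2 * (norm s + norm t) / m) ^ n / (fact n)\<^sup>2"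
    by (simp only: power_mult_distrib power_divide times_divide_eq_left)
  finally show ?thesis .
qed

text \<open>
  Bailey's factorization of \<open>F_4\<close> near the origin. For fixed \<open>Y\<close> the series converges uniformly to a
  holomorphic function of \<open>X\<close>. By the telescoping identity, the Taylor coefficients of the partial sums
  satisfy the hypergeometric recurrence up to an error tending to \<open>0\<close>, so those of the limit satisfy it
  exactly. Hence the limit is a multiple of \<open>F(a, b; c; X)\<close>, and its value at \<open>X = 0\<close> is the series of
  \<open>F(a, b; c'; Y)\<close>.
\<close>

lemma Bailey_local:
  assumes cc: "c + c' = a + b + 1" and c: "Re c > 0" "Re c' > 0"
  shows "\<exists>\<delta>>0. \<forall>X Y. norm X < \<delta> \<longrightarrow> norm Y < \<delta> \<longrightarrow>
     (\<lambda>n. pochhammer a n * pochhammer b n * f4_form c c' n (X * (1 - Y)) (Y * (1 - X))) sums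
       (eval_fps (hyp_fps a b c) X * eval_fps (hyp_fps a b c') Y)"
proof -
  define m where "m = min 1 (min (Re c) (Re c'))"
  have m: "0 < m" "m \<le> 1" "m \<le> Re c" "m \<le> Re c'" using c by (auto simp: m_def)
  define A B where "A = 1 + norm a" and "B = 1 + norm b"
  have AB: "A \<ge> 1" "B \<ge> 1" by (auto simp: A_def B_def)
  define K where "K = 2 * A * B / m"
  have K: "K \<ge> 1"
  proof -
    have "1 * 1 \<le> A * B" using AB by (intro mult_mono) auto
    thus ?thesis using m by (simp add: K_def field_simps)
  qed
  \<comment> \<open>With this radius the terms are at most \<open>8^-n\<close>, which leaves room for the factor \<open>4^n\<close> in the error term.\<close>
  define \<delta> where "\<delta> = 1 / (32 * K)"
  have \<delta>: "0 < \<delta>" "\<delta> < 1" using K by (auto simp: \<delta>_def field_simps)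
  define g where "g = (\<lambda>y n X. pochhammer a n * pochhammer b n * f4_form c c' n (X * (1 - y)) (y * (1 - X)))"
  have g_le: "norm (g y n X) \<le> (1 / 8) ^ n" if X: "norm X < \<delta>" and y: "norm y < \<delta>" for X y n
  proof -
    let ?s = "X * (1 - y)" and ?t = "y * (1 - X)"
    have 2: "norm (1 - z) \<le> 2" if "norm z < \<delta>" for z :: complex
      using norm_triangle_ineq4[of 1 z] that \<delta> by simp
    have "norm ?s + norm ?t \<le> \<delta> * 2 + \<delta> * 2"
      unfolding norm_mult using X y \<delta> 2[OF X] 2[OF y] by (intro add_mono mult_mono) auto
    hence st: "K * (norm ?s + norm ?t) \<le> 1 / 8" using K by (simp add: \<delta>_def field_simps)
    have "norm (g y n X) \<le> (fact n * A ^ n) * (fact n * B ^ n) * ((2 * (norm ?s + norm ?t) / m) ^ n / (fact n)\<^sup>2)"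
      unfolding g_def norm_mult[of "_ * _"] norm_mult[of "pochhammer _ _"] A_def B_def
      by (intro mult_mono norm_pochhammer_le norm_f4_form_le m) auto
    also have "\<dots> = (K * (norm ?s + norm ?t)) ^ n"
      by (simp add: K_def power_mult_distrib power_divide power2_eq_square mult_ac)
    also have "\<dots> \<le> (1 / 8) ^ n" using st K by (intro power_mono) auto
    finally show ?thesis .
  qed
  have "(\<lambda>n. g y n X) sums (eval_fps (hyp_fps a b c) X * eval_fps (hyp_fps a b c') y)"
    if X: "norm X < \<delta>" and y: "norm y < \<delta>" for X y
  proof -
    define G where "G = (\<lambda>X. \<Sum>n. g y n X)"
    define P where "P = (\<lambda>N X. \<Sum>n<N. g y n X)"
    have sm: "summable (\<lambda>n. g y n X)" if "norm X < \<delta>" for X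
      by (rule summable_comparison_test'[of "\<lambda>n. (1 / 8) ^ n" 0]) (use g_le that y in \<open>auto intro!: summable_geometric\<close>)
    have "uniform_limit (ball 0 \<delta>) P G sequentially"
      unfolding P_def G_def
      by (rule Weierstrass_m_test[of _ _ "\<lambda>n. (1 / 8) ^ n"]) (use g_le y in \<open>auto intro!: summable_geometric\<close>)
    hence unif: "uniform_limit (ball 0 \<delta>) (\<lambda>N. P (Suc N)) G sequentially"
      by (rule filterlim_compose) (rule filterlim_Suc)
    have g_holo: "(\<lambda>X. g y n X) holomorphic_on A" for n A
      unfolding g_def f4_form_def by (intro holomorphic_intros)
    have P_holo: "P N holomorphic_on A" for N A
      unfolding P_def by (intro holomorphic_intros g_holo)
    have G_holo: "G holomorphic_on ball 0 \<delta>"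
    proof (rule holomorphic_uniform_sequence[OF open_ball])
      show "P (Suc N) holomorphic_on ball 0 \<delta>" for N by (rule P_holo)
      fix x :: complex assume "x \<in> ball 0 \<delta>"
      then obtain d where "0 < d" "cball x d \<subseteq> ball 0 \<delta>" using open_contains_cball open_ball by blast
      thus "\<exists>d>0. cball x d \<subseteq> ball 0 \<delta> \<and> uniform_limit (cball x d) (\<lambda>N. P (Suc N)) G sequentially"
        using uniform_limit_on_subset[OF unif] by blast
    qed
    define coef where "coef = (\<lambda>k. (deriv ^^ k) G 0 / fact k)"
    have P_exp: "P (Suc N) has_fps_expansion f4_partial a b c c' y N" for N
      unfolding P_def g_def f4_partial_def lessThan_Suc_atMost
      by (intro fps_expansion_intros f4_has_fps_expansion)
    have P_lim: "(\<lambda>N. f4_partial a b c c' y N $ k) \<longlonglongrightarrow> coef k" for k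
    proof -
      have "(\<lambda>N. (deriv ^^ k) (P (Suc N)) 0) \<longlonglongrightarrow> (deriv ^^ k) G 0"
        by (rule higher_deriv_complex_uniform_limit[OF unif]) (use \<delta> P_holo in auto)
      hence "(\<lambda>N. (deriv ^^ k) (P (Suc N)) 0 / fact k) \<longlonglongrightarrow> coef k"
        unfolding coef_def by (intro tendsto_intros) auto
      thus ?thesis using fps_nth_fps_expansion[OF P_exp] by simp
    qed
    \<comment> \<open>By the telescoping identity, the hypergeometric operator maps the partial sum to \<open>- E N\<close>.\<close>
    define E where "E = (\<lambda>N X. pochhammer a (Suc N) * pochhammer b (Suc N) * f4_form c c' N (X * (1 - y)) (y * (1 - X)))"
    have E_g: "E N X = (a + of_nat N) * (b + of_nat N) * g y N X" for N X
      by (simp add: E_def g_def pochhammer_Suc mult_ac)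
    have E_le: "norm (E N X) \<le> A * B * (1 / 2) ^ N" if X: "norm X < \<delta>" for N X
    proof -
      have lin: "norm (z + of_nat N) \<le> (1 + norm z) * 2 ^ N" for z :: complex
      proof -
        have "norm (z + of_nat N) \<le> norm z + real N" by (metis norm_of_nat norm_triangle_ineq)
        also have "\<dots> \<le> (1 + norm z) * real (Suc N)" by (simp add: algebra_simps)
        also have "\<dots> \<le> (1 + norm z) * 2 ^ N"
        proof (rule mult_left_mono)
          have "real (Suc N) \<le> real (2 ^ N)"
            using less_exp[of N] by (simp only: of_nat_le_iff Suc_le_eq)
          thus "real (Suc N) \<le> 2 ^ N" by simp
        qed auto
        finally show ?thesis .
      qed
      have "norm (E N X) \<le> (A * 2 ^ N) * (B * 2 ^ N) * (1 / 8) ^ N"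
        unfolding E_g norm_mult A_def B_def using X y by (intro mult_mono lin g_le) auto
      also have "\<dots> = A * B * ((2 * 2 * (1 / 8)) ^ N)" unfolding power_mult_distrib by simp
      finally show ?thesis by simp
    qed
    have E_lim: "uniform_limit (ball 0 \<delta>) E (\<lambda>_. 0) sequentially"
    proof (rule uniform_limitI)
      fix e :: real assume "e > 0"
      have "(\<lambda>N. A * B * (1 / 2) ^ N) \<longlonglongrightarrow> A * B * 0"
        by (intro tendsto_intros LIMSEQ_power_zero) auto
      hence "eventually (\<lambda>N. A * B * (1 / 2) ^ N < e) sequentially"
        using \<open>e > 0\<close> by (intro order_tendstoD) auto
      thus "eventually (\<lambda>N. \<forall>X\<in>ball 0 \<delta>. dist (E N X) 0 < e) sequentially"
        by eventually_elim (auto intro: order.strict_trans1[OF E_le])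
    qed
    have E_exp: "(\<lambda>X. - E N X) has_fps_expansion hyp_ode a b c (f4_partial a b c c' y N)" for N
      unfolding E_def hyp_ode_f4_partial[OF assms]
      by (intro fps_expansion_intros f4_has_fps_expansion)
    have ode_lim: "(\<lambda>N. hyp_ode a b c (f4_partial a b c c' y N) $ k) \<longlonglongrightarrow> 0" for k
    proof -
      have "uniform_limit (ball 0 \<delta>) (\<lambda>N X. - E N X) (\<lambda>_. - 0) sequentially"
        by (intro uniform_limit_intros E_lim)
      moreover have "(\<lambda>X. - E N X) holomorphic_on ball 0 \<delta>" for N
        unfolding E_def f4_form_def by (intro holomorphic_intros)
      ultimately have "(\<lambda>N. (deriv ^^ k) (\<lambda>X. - E N X) 0) \<longlonglongrightarrow> (deriv ^^ k) (\<lambda>_. - 0) 0"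
        by (intro higher_deriv_complex_uniform_limit) (use \<delta> in auto)
      hence "(\<lambda>N. (deriv ^^ k) (\<lambda>X. - E N X) 0 / fact k) \<longlonglongrightarrow> (deriv ^^ k) (\<lambda>_. - 0) 0 / fact k"
        by (intro tendsto_intros) auto
      thus ?thesis by (simp add: fps_nth_fps_expansion[OF E_exp] higher_deriv_const)
    qed
    have rec: "of_nat (Suc k) * (c + of_nat k) * coef (Suc k) = (a + of_nat k) * (b + of_nat k) * coef k" for k
    proof -
      have "(\<lambda>N. hyp_ode a b c (f4_partial a b c c' y N) $ k) \<longlonglongrightarrow>
         of_nat (Suc k) * (c + of_nat k) * coef (Suc k) - (a + of_nat k) * (b + of_nat k) * coef k"
        unfolding hyp_ode_nth by (intro tendsto_intros P_lim)
      from LIMSEQ_unique[OF this ode_lim] show ?thesis by simp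
    qed
    have coef: "coef k = coef 0 * hyp_fps a b c $ k" for k
      by (rule hyp_recurrence_unique[where f = coef, OF c(1)]) (rule rec)
    have "coef 0 = eval_fps (hyp_fps a b c') y"
    proof -
      have "f4_form c c' n 0 y = f4_coeff c' n * y ^ n" for n
        unfolding f4_form_def by (subst sum.remove[of _ 0]) (auto simp: f4_coeff_def intro!: sum.neutral)
      thus ?thesis by (simp add: coef_def G_def g_def eval_fps_def hyp_fps_def f4_coeff_def)
    qed
    moreover have "G X = coef 0 * eval_fps (hyp_fps a b c) X"
    proof -
      have "(\<lambda>k. coef k * X ^ k) sums G X"
        using holomorphic_power_series[OF G_holo, of X] X by (simp add: coef_def)
      also have "(\<lambda>k. coef k * X ^ k) = (\<lambda>k. coef 0 * (hyp_fps a b c $ k * X ^ k))"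
        by (rule ext, subst coef, rule mult.assoc)
      finally have "G X = (\<Sum>k. coef 0 * (hyp_fps a b c $ k * X ^ k))"
        by (rule sums_unique)
      moreover have "summable (\<lambda>k. hyp_fps a b c $ k * X ^ k)"
        using X \<delta> by (intro summable_fps less_le_trans[OF _ fps_conv_radius_hyp_fps]) auto
      ultimately show ?thesis by (simp add: suminf_mult eval_fps_def)
    qed
    ultimately have "G X = eval_fps (hyp_fps a b c) X * eval_fps (hyp_fps a b c') y" by simp
    moreover have "(\<lambda>n. g y n X) sums G X" using sm[OF X] by (simp add: G_def summable_sums)
    ultimately show ?thesis by simp
  qed
  thus ?thesis using \<delta> unfolding g_def by blast
qed

section \<open>Gegenbauer polynomials as homogeneous forms\<close>

text \<open>
  The Gegenbauer polynomial as a real function, expanded in powers of \<open>(1 - x) / 2\<close>. Real values keep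
  the orthogonality computation inside real Beta integrals.
\<close>

definition ultra :: "real \<Rightarrow> nat \<Rightarrow> real \<Rightarrow> real" where
  "ultra \<mu> n x = (\<Sum>k\<le>n. (- 1) ^ k * pochhammer (2 * \<mu>) (n + k) /
      (pochhammer (\<mu> + 1 / 2) k * fact k * fact (n - k)) * ((1 - x) / 2) ^ k)"

lemma gegenbauer_eq_ultra: "gegenbauer n (of_real \<mu>) (of_real x) = of_real (ultra \<mu> n x)"
proof -
  let ?y = "(1 - complex_of_real x) / 2"
  let ?t = "hyp2F1_term (- of_nat n) (of_nat n + 2 * of_real \<mu>) (of_real \<mu> + 1 / 2) ?y"
  have "?t k = 0" if "k \<notin> {..n}" for k
    using that by (auto simp: hyp2F1_term_def pochhammer_eq_0_iff)
  hence "(\<Sum>k. ?t k) = (\<Sum>k\<le>n. ?t k)" by (intro suminf_finite) auto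
  hence "gegenbauer n (of_real \<mu>) (of_real x) = pochhammer (2 * of_real \<mu>) n / fact n * (\<Sum>k\<le>n. ?t k)"
    by (simp add: gegenbauer_def hyp2F1_def)
  also have "\<dots> = (\<Sum>k\<le>n. of_real ((- 1) ^ k * pochhammer (2 * \<mu>) (n + k) /
      (pochhammer (\<mu> + 1 / 2) k * fact k * fact (n - k)) * ((1 - x) / 2) ^ k))"
    unfolding sum_distrib_left
  proof (rule sum.cong[OF refl], goal_cases)
    case (1 k)
    have m: "pochhammer (- of_nat n) k = (- 1) ^ k * (fact n / fact (n - k) :: complex)"
    proof -
      have "pochhammer (- of_nat n) k = (- 1) ^ k * pochhammer (of_nat n - of_nat k + 1 :: complex) k"
        by (rule pochhammer_minus)
      also have "of_nat n - of_nat k + 1 = (of_nat (n - k + 1) :: complex)" using 1 by simp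
      also have "pochhammer (of_nat (n - k + 1) :: complex) k = fact n / fact (n - k)"
      proof -
        have "pochhammer 1 (n - k + k) = pochhammer 1 (n - k) * pochhammer (1 + of_nat (n - k) :: complex) k"
          by (rule pochhammer_product')
        moreover have "n - k + k = n" "1 + of_nat (n - k) = (of_nat (n - k + 1) :: complex)" using 1 by simp_all
        ultimately have "fact n = fact (n - k) * pochhammer (of_nat (n - k + 1) :: complex) k"
          by (simp only: pochhammer_fact)
        thus ?thesis by (simp only: nonzero_mult_div_cancel_left[OF fact_nonzero])
      qed
      finally show ?thesis .
    qed
    have p: "pochhammer (2 * of_real \<mu>) n * pochhammer (of_nat n + 2 * of_real \<mu>) k
       = complex_of_real (pochhammer (2 * \<mu>) (n + k))"
      using pochhammer_product'[of "2 * complex_of_real \<mu>" n k]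
      by (simp add: add.commute flip: pochhammer_of_real)
    have c: "pochhammer (of_real \<mu> + 1 / 2) k = complex_of_real (pochhammer (\<mu> + 1 / 2) k)"
      by (simp flip: pochhammer_of_real)
    have alg: "A / F * (s * (F / G) * B / (C * K) * Y) = s * (A * B) / (C * K * G) * Y"
      if "F \<noteq> 0" for A F s G B C K Y :: complex using that by (simp add: mult_ac)
    show ?case
      unfolding hyp2F1_term_def m c alg[OF fact_nonzero] p by simp
  qed
  finally show ?thesis by (simp add: ultra_def)
qed

text \<open>
  The Vandermonde convolution of rising factorials, after the reflection
  \<open>(-z)_j = (-1)^j (z - j + 1)_j\<close> of both factors.
\<close>

lemma pochhammer_convolution:
  fixes c d :: real
  shows "(\<Sum>j\<le>k. real (k choose j) * pochhammer (c + real j) (k - j) * pochhammer (d - real j) j)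
    = pochhammer (c + d - 1) k"
proof -
  have "pochhammer ((1 - d) + (1 - c - real k)) k = (\<Sum>j\<le>k. real (k choose j) * pochhammer (1 - d) j * pochhammer (1 - c - real k) (k - j))"
    by (rule pochhammer_binomial_sum)
  also have "\<dots> = (\<Sum>j\<le>k. (- 1) ^ k * (real (k choose j) * pochhammer (c + real j) (k - j) * pochhammer (d - real j) j))"
  proof (rule sum.cong[OF refl], goal_cases)
    case (1 j)
    hence j: "j \<le> k" by simp
    have "pochhammer (1 - d) j = (- 1) ^ j * pochhammer (d - real j) j"
      using pochhammer_minus[of "d - 1" j] by simp
    moreover have "pochhammer (1 - c - real k) (k - j) = (- 1) ^ (k - j) * pochhammer (c + real j) (k - j)"
      using pochhammer_minus[of "c + real k - 1" "k - j"] j by (simp add: algebra_simps of_nat_diff)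
    moreover have "(- 1) ^ j * (- 1) ^ (k - j) = ((- 1) ^ k :: real)"
      using j by (simp flip: power_add)
    ultimately show ?case by (simp add: mult_ac)
  qed
  also have "\<dots> = (- 1) ^ k * (\<Sum>j\<le>k. real (k choose j) * pochhammer (c + real j) (k - j) * pochhammer (d - real j) j)"
    by (simp add: sum_distrib_left)
  also have "pochhammer ((1 - d) + (1 - c - real k)) k = (- 1) ^ k * pochhammer (c + d - 1) k"
    using pochhammer_minus[of "c + d - 2 + real k" k] by (simp add: algebra_simps)
  finally show ?thesis by simp
qed

text \<open>
  The homogeneous form at \<open>s = -y\<close>, \<open>t = 1 - y\<close>. With \<open>y = (1 - x) / 2\<close> this is, up to normalization,
  the symmetric expression of the Gegenbauer polynomial in powers of \<open>x - 1\<close> and \<open>x + 1\<close>.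
\<close>

definition jacobi_form :: "real \<Rightarrow> nat \<Rightarrow> real \<Rightarrow> real" where
  "jacobi_form c n y = (\<Sum>j\<le>n. (- y) ^ j * (1 - y) ^ (n - j) /
      (pochhammer c j * fact j * (pochhammer c (n - j) * fact (n - j))))"

lemma f4_form_eq_jacobi_form:
  "f4_form (of_real c) (of_real c) n (of_real (- y)) (of_real (1 - y)) = of_real (jacobi_form c n y)"
  by (simp add: f4_form_def jacobi_form_def f4_coeff_def pochhammer_of_real divide_simps)

lemma jacobi_form_expand:
  assumes c: "c > 0"
  shows "pochhammer c n * jacobi_form c n y =
     (\<Sum>k\<le>n. pochhammer (2 * c - 1 + real n) k / (pochhammer c k * fact k * fact (n - k)) * (- y) ^ k)"
proof -
  have pc: "pochhammer c k \<noteq> 0" for k using pochhammer_pos[OF c, of k] by simp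
  define e where "e = (\<lambda>j. 1 / (pochhammer c j * fact j))"
  have "jacobi_form c n y = (\<Sum>j\<le>n. \<Sum>i\<le>n - j. e j * e (n - j) * real (n - j choose i) * (- y) ^ (j + i))"
  proof -
    have "(1 - y) ^ m = (\<Sum>i\<le>m. real (m choose i) * (- y) ^ i)" for m
      using binomial_ring[of "- y" 1 m] by simp
    thus ?thesis
      by (simp add: jacobi_form_def e_def sum_distrib_left sum_divide_distrib power_add mult_ac)
  qed
  also have "\<dots> = (\<Sum>(j, i)\<in>{(j, i). j + i \<le> n}. e j * e (n - j) * real (n - j choose i) * (- y) ^ (j + i))"
    by (subst sum.Sigma) (auto intro!: sum.cong)
  also have "\<dots> = (\<Sum>k\<le>n. \<Sum>j\<le>k. e j * e (n - j) * real (n - j choose (k - j)) * (- y) ^ (j + (k - j)))"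
    by (rule sum.triangle_reindex_eq)
  finally have "pochhammer c n * jacobi_form c n y =
     (\<Sum>k\<le>n. pochhammer c n * (\<Sum>j\<le>k. e j * e (n - j) * real (n - j choose (k - j)) * (- y) ^ (j + (k - j))))"
    by (simp add: sum_distrib_left)
  also have "\<dots> = (\<Sum>k\<le>n. pochhammer (2 * c - 1 + real n) k / (pochhammer c k * fact k * fact (n - k)) * (- y) ^ k)"
  proof (rule sum.cong[OF refl], goal_cases)
    case (1 k)
    hence k: "k \<le> n" by simp
    have "pochhammer c n * (e j * e (n - j) * real (n - j choose (k - j)) * (- y) ^ (j + (k - j)))
       = (- y) ^ k / (pochhammer c k * fact k * fact (n - k)) *
         (real (k choose j) * pochhammer (c + real j) (k - j) * pochhammer (c + real n - real j) j)"
      if "j \<le> k" for j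
    proof -
      have j: "j \<le> k" "j \<le> n" using that k by auto
      have 1: "pochhammer c k = pochhammer c j * pochhammer (c + real j) (k - j)"
        using pochhammer_product[OF j(1), of c] .
      have 2: "pochhammer c n = pochhammer c (n - j) * pochhammer (c + real n - real j) j"
        using pochhammer_product[of "n - j" n c] j by (simp add: of_nat_diff algebra_simps)
      have 3: "real (n - j choose (k - j)) = fact (n - j) / (fact (k - j) * fact (n - k))"
        using j k by (subst binomial_fact) auto
      have 4: "real (k choose j) = fact k / (fact j * fact (k - j))"
        using j by (subst binomial_fact) auto
      have "pochhammer (c + real j) (k - j) \<noteq> 0" using 1 pc[of k] by auto
      moreover have "j + (k - j) = k" using j by simp
      ultimately show ?thesis unfolding 1 2 3 4 e_def using pc[of j] pc[of "n - j"]
        by (simp add: divide_simps)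
    qed
    hence "pochhammer c n * (\<Sum>j\<le>k. e j * e (n - j) * real (n - j choose (k - j)) * (- y) ^ (j + (k - j)))
      = (- y) ^ k / (pochhammer c k * fact k * fact (n - k)) *
      (\<Sum>j\<le>k. real (k choose j) * pochhammer (c + real j) (k - j) * pochhammer (c + real n - real j) j)"
      by (simp add: sum_distrib_left)
    also have "(\<Sum>j\<le>k. real (k choose j) * pochhammer (c + real j) (k - j) * pochhammer (c + real n - real j) j)
       = pochhammer (2 * c - 1 + real n) k"
      using pochhammer_convolution[where c = c and d = "c + real n" and k = k] by (simp add: algebra_simps)
    finally show ?case by (simp add: mult_ac)
  qed
  finally show ?thesis .
qed

text \<open>
  The bridge between the product formula and orthogonality: the homogeneous parts of the Appell series
  along the curve of the product formula are multiples of Gegenbauer polynomials.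
\<close>

lemma ultra_eq_jacobi_form:
  assumes "\<mu> > - 1 / 2"
  shows "ultra \<mu> n x = pochhammer (\<mu> + 1 / 2) n * pochhammer (2 * \<mu>) n * jacobi_form (\<mu> + 1 / 2) n ((1 - x) / 2)"
proof -
  let ?c = "\<mu> + 1 / 2" and ?y = "(1 - x) / 2"
  have "ultra \<mu> n x = (\<Sum>k\<le>n. pochhammer (2 * \<mu>) n *
      (pochhammer (2 * ?c - 1 + real n) k / (pochhammer ?c k * fact k * fact (n - k)) * (- ?y) ^ k))"
    unfolding ultra_def pochhammer_product'[of "2 * \<mu>" n] power_minus[of ?y]
    by (simp add: algebra_simps)
  also have "\<dots> = pochhammer (2 * \<mu>) n * (pochhammer ?c n * jacobi_form ?c n ?y)"
    by (subst jacobi_form_expand) (use assms in \<open>simp_all add: sum_distrib_left\<close>)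
  finally show ?thesis by simp
qed

section \<open>Brafman's product formula\<close>

lemma f4_form_scale: "f4_form c c' n (r * s) (r * t) = r ^ n * f4_form c c' n s t"
proof -
  have "r ^ n = r ^ j * r ^ (n - j)" if "j \<le> n" for j
    using that by (simp flip: power_add)
  thus ?thesis
    by (simp add: f4_form_def sum_distrib_left power_mult_distrib mult_ac)
qed

text \<open>
  The series in \<open>r\<close> obtained from the Appell series at \<open>s = r (x - 1) / 2\<close>, \<open>t = r (x + 1) / 2\<close>, summed
  by homogeneous degree.
\<close>

definition brafman_fps :: "complex \<Rightarrow> complex \<Rightarrow> complex \<Rightarrow> complex \<Rightarrow> complex fps" where
  "brafman_fps a b c x =
     Abs_fps (\<lambda>n. pochhammer a n * pochhammer b n * f4_form c c n ((x - 1) / 2) ((x + 1) / 2))"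

lemma sqrt_between:
  fixes x r :: real
  assumes x: "-1 < x" "x < 1" and r: "0 \<le> r" "r < 1"
  defines "R \<equiv> sqrt (1 + r\<^sup>2 - 2 * r * x)"
  shows "1 - r \<le> R" "R \<le> 1 + r" "0 < 1 + r\<^sup>2 - 2 * r * x"
proof -
  have 1: "(1 - r)\<^sup>2 \<le> 1 + r\<^sup>2 - 2 * r * x" and 2: "1 + r\<^sup>2 - 2 * r * x \<le> (1 + r)\<^sup>2"
    using mult_left_mono[of x 1 r] mult_left_mono[of "-1" x r] x r by (auto simp: power2_eq_square algebra_simps)
  show "1 - r \<le> R" unfolding R_def using 1 by (rule real_le_rsqrt)
  show "R \<le> 1 + r" unfolding R_def using 2 r by (intro real_le_lsqrt) auto
  have "0 < (1 - r)\<^sup>2" using r by simp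
  thus "0 < 1 + r\<^sup>2 - 2 * r * x" using 1 by linarith
qed

text \<open>
  Put \<open>u = (1 - R - r) / 2\<close>, \<open>v = (1 - R + r) / 2\<close>. Because \<open>R^2 = 1 + r^2 - 2 r x\<close>, Bailey's arguments
  become \<open>u (1 - v) = r (x - 1) / 2\<close> and \<open>v (1 - u) = r (x + 1) / 2\<close>, so the factorization is the claim
  for small \<open>r\<close>. Absolute convergence of the double series may fail for larger \<open>r\<close>. The series by degree,
  however, converges in the unit disc, so both sides are analytic near the segment \<open>[0, r]\<close> and agree by
  continuation. The region of continuation is the component of \<open>0\<close> in the set \<open>S\<close> where the principal
  root is analytic and both \<open>u\<close> and \<open>v\<close> lie in the unit disc.
\<close>

lemma Brafman:
  fixes x r :: real
  assumes abc: "2 * c = a + b + 1" and c: "Re c > 0"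
    and x: "-1 < x" "x < 1" and r: "0 < r" "r < 1"
    and conv: "fps_conv_radius (brafman_fps a b c (of_real x)) \<ge> 1"
  defines "R \<equiv> sqrt (1 + r\<^sup>2 - 2 * r * x)"
  shows "eval_fps (hyp_fps a b c) (of_real ((1 - R - r) / 2)) * eval_fps (hyp_fps a b c) (of_real ((1 - R + r) / 2))
     = eval_fps (brafman_fps a b c (of_real x)) (of_real r)"
proof -
  define q where "q = (\<lambda>z::complex. 1 + z\<^sup>2 - 2 * z * of_real x)"
  define W where "W = (\<lambda>z. csqrt (q z))"
  define u v where "u = (\<lambda>z. (1 - W z - z) / 2)" and "v = (\<lambda>z. (1 - W z + z) / 2)"
  define U where "U = ball 0 1 \<inter> q -` (- \<real>\<^sub>\<le>\<^sub>0)"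
  define S where "S = (U \<inter> u -` ball 0 1) \<inter> (U \<inter> v -` ball 0 1)"
  have "open U"
    unfolding U_def q_def
    by (intro open_Int open_ball open_vimage open_Compl closed_nonpos_Reals_complex continuous_intros)
  have W_holo: "W holomorphic_on U"
    unfolding W_def by (rule holomorphic_on_csqrt') (auto simp: U_def q_def intro!: holomorphic_intros)
  hence uv_holo: "u holomorphic_on U" "v holomorphic_on U"
    unfolding u_def v_def by (auto intro!: holomorphic_intros)
  have "open S"
    unfolding S_def
    by (intro open_Int continuous_open_preimage holomorphic_on_imp_continuous_on uv_holo \<open>open U\<close> open_ball)
  have real: "of_real t \<in> S \<and> W (of_real t) = of_real (sqrt (1 + t\<^sup>2 - 2 * t * x))" if t: "0 \<le> t" "t < 1" for t
  proof -
    note b = sqrt_between[OF x t]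
    have q: "q (of_real t) = of_real (1 + t\<^sup>2 - 2 * t * x)" by (simp add: q_def)
    have W: "W (of_real t) = of_real (sqrt (1 + t\<^sup>2 - 2 * t * x))"
      unfolding W_def q using b(3) by (simp add: csqrt_of_real_nonneg del: of_real_add of_real_diff of_real_mult)
    have "u (of_real t) = of_real ((1 - sqrt (1 + t\<^sup>2 - 2 * t * x) - t) / 2)"
         "v (of_real t) = of_real ((1 - sqrt (1 + t\<^sup>2 - 2 * t * x) + t) / 2)"
      unfolding u_def v_def W by simp_all
    hence "norm (u (of_real t)) < 1" "norm (v (of_real t)) < 1"
      using b(1,2) t by (simp_all only: norm_of_real) (auto simp: abs_less_iff)
    moreover have "of_real t \<in> U" unfolding U_def using t b(3) q by (simp del: of_real_add of_real_diff of_real_mult)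
    ultimately show ?thesis using W by (simp add: S_def)
  qed
  define C where "C = connected_component_set S 0"
  have C: "open C" "connected C" "C \<subseteq> S"
    unfolding C_def using \<open>open S\<close> by (auto simp: open_connected_component connected_component_subset)
  have "0 \<in> S" using real[of 0] by simp
  have rC: "of_real r \<in> C"
  proof -
    have "connected (complex_of_real ` {0..r})"
      by (intro connected_continuous_image continuous_intros) auto
    hence "complex_of_real ` {0..r} \<subseteq> C"
      unfolding C_def by (intro connected_component_maximal) (use real r in force)+
    thus ?thesis using r by auto
  qed
  let ?H = "eval_fps (hyp_fps a b c)" and ?B = "eval_fps (brafman_fps a b c (of_real x))"
  obtain \<delta> where \<delta>: "\<delta> > 0" and bailey: "\<And>X Y. norm X < \<delta> \<Longrightarrow> norm Y < \<delta> \<Longrightarrow>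
     (\<lambda>n. pochhammer a n * pochhammer b n * f4_form c c n (X * (1 - Y)) (Y * (1 - X))) sums (?H X * ?H Y)"
    using Bailey_local[of c c a b] abc c by auto
  have "open ((U \<inter> u -` ball 0 \<delta>) \<inter> (U \<inter> v -` ball 0 \<delta>) \<inter> S)"
    by (intro open_Int continuous_open_preimage holomorphic_on_imp_continuous_on uv_holo \<open>open U\<close> open_ball \<open>open S\<close>)
  moreover have "0 \<in> (U \<inter> u -` ball 0 \<delta>) \<inter> (U \<inter> v -` ball 0 \<delta>) \<inter> S"
    using real[of 0] \<delta> by (auto simp: S_def u_def v_def)
  ultimately obtain d where d: "d > 0" "ball 0 d \<subseteq> (U \<inter> u -` ball 0 \<delta>) \<inter> (U \<inter> v -` ball 0 \<delta>) \<inter> S"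
    by (meson open_contains_ball)
  have dC: "ball 0 d \<subseteq> C"
    unfolding C_def using d by (intro connected_component_maximal) auto
  have lt1: "z \<in> eball 0 (fps_conv_radius F)" if "norm z < 1" "fps_conv_radius F \<ge> 1" for z :: complex and F :: "complex fps"
    using less_le_trans[OF _ that(2), of "ereal (norm z)"] that(1) by (simp add: in_eball_iff)
  have "?H (u (of_real r)) * ?H (v (of_real r)) = ?B (of_real r)"
  proof (rule analytic_continuation_open[of "ball 0 d" C "\<lambda>z. ?H (u z) * ?H (v z)" ?B])
    have H: "?H holomorphic_on ball 0 1"
      by (rule holomorphic_on_eval_fps) (use lt1 fps_conv_radius_hyp_fps in auto)
    have "?H \<circ> u holomorphic_on C" "?H \<circ> v holomorphic_on C"
      by (rule holomorphic_on_compose_gen[OF holomorphic_on_subset[OF uv_holo(1)] H]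
            holomorphic_on_compose_gen[OF holomorphic_on_subset[OF uv_holo(2)] H]; use C(3) in \<open>auto simp: S_def\<close>)+
    thus "(\<lambda>z. ?H (u z) * ?H (v z)) holomorphic_on C"
      by (auto intro!: holomorphic_intros simp: o_def)
    show "?B holomorphic_on C"
      by (rule holomorphic_on_eval_fps) (use lt1 conv C(3) in \<open>auto simp: S_def U_def\<close>)
    fix z :: complex assume z: "z \<in> ball 0 d"
    have W2: "(W z)\<^sup>2 = 1 + z\<^sup>2 - 2 * z * of_real x" by (simp add: W_def q_def)
    have e: "((1 - z)\<^sup>2 - (1 + z\<^sup>2 - 2 * z * of_real x)) / 4 = z * ((of_real x - 1) / 2)"
      "((1 + z)\<^sup>2 - (1 + z\<^sup>2 - 2 * z * of_real x)) / 4 = z * ((of_real x + 1) / 2)"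
      by (simp_all add: power2_eq_square field_simps)
    have "u z * (1 - v z) = ((1 - z)\<^sup>2 - (W z)\<^sup>2) / 4" "v z * (1 - u z) = ((1 + z)\<^sup>2 - (W z)\<^sup>2) / 4"
      by (simp_all add: u_def v_def power2_eq_square field_simps)
    from this[unfolded W2 e]
    have s: "u z * (1 - v z) = z * ((of_real x - 1) / 2)" and t: "v z * (1 - u z) = z * ((of_real x + 1) / 2)" .
    have "norm (u z) < \<delta>" "norm (v z) < \<delta>" using z d by auto
    from bailey[OF this] have "(\<lambda>n. brafman_fps a b c (of_real x) $ n * z ^ n) sums (?H (u z) * ?H (v z))"
      unfolding s t f4_form_scale by (simp add: brafman_fps_def mult_ac)
    thus "?H (u z) * ?H (v z) = ?B z" by (simp add: eval_fps_def sums_iff)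
  qed (use C d dC rC in auto)
  thus ?thesis using real[of r] r by (simp add: u_def v_def R_def)
qed

section \<open>A uniform bound for Gegenbauer polynomials\<close>

text \<open>
  The coefficients of the expansion above, extended by \<open>0\<close> so that polynomials of different degrees can
  be summed over a common range.
\<close>

definition ultra_coeff :: "real \<Rightarrow> nat \<Rightarrow> nat \<Rightarrow> real" where
  "ultra_coeff \<mu> n k = (if k \<le> n then (- 1) ^ k * pochhammer (2 * \<mu>) (n + k) /
      (pochhammer (\<mu> + 1 / 2) k * fact k * fact (n - k)) else 0)"

lemma ultra_eq_sum_coeff: "n \<le> N \<Longrightarrow> ultra \<mu> n x = (\<Sum>k\<le>N. ultra_coeff \<mu> n k * ((1 - x) / 2) ^ k)"
  unfolding ultra_def ultra_coeff_def by (rule sum.mono_neutral_cong_left) auto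

text \<open>
  The three-term recurrence at the level of coefficients. Multiplication by \<open>x = 1 - 2 y\<close> produces the
  shifted coefficient on the right. The cases distinguish which of the three polynomials has a term of
  degree \<open>k\<close>; in each of them all coefficients are rational multiples of one number \<open>q\<close>.
\<close>

lemma ultra_coeff_rec:
  assumes \<mu>: "\<mu> > - 1 / 2"
  shows "real (n + 2) * ultra_coeff \<mu> (n + 2) k + (real n + 2 * \<mu>) * ultra_coeff \<mu> n k =
     2 * (real n + 1 + \<mu>) * (ultra_coeff \<mu> (n + 1) k - (if k = 0 then 0 else 2 * ultra_coeff \<mu> (n + 1) (k - 1)))"
proof -
  define c M where "c = \<mu> + 1 / 2" and "M = 2 * \<mu>"
  have M: "\<mu> = M / 2" "c = (M + 1) / 2" by (simp_all add: M_def c_def)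
  have pc: "pochhammer c k \<noteq> 0" for k
    using \<mu> pochhammer_pos[of c k] by (simp add: c_def)
  have c_add: "M + 1 + 2 * real k > 0" for k using \<mu> by (simp add: M_def)
  have T: "ultra_coeff \<mu> m k = (if k \<le> m then (- 1) ^ k * pochhammer M (m + k) /
      (pochhammer c k * fact k * fact (m - k)) else 0)" for m k
    by (simp add: ultra_coeff_def c_def M_def)
  have p1: "pochhammer M (Suc m) = pochhammer M m * (M + real m)" for m
    by (rule pochhammer_Suc)
  show ?thesis
  proof (cases k)
    case 0
    have goal_simps: "2 * \<mu> = M" "\<And>x. x + \<mu> = x + M / 2"
        "\<And>x y. (if 0 = (0 :: nat) then x else y :: real) = x" "\<And>x. x - 0 = (x :: real)"
      by (simp_all add: M(1))
    define q N where "q = pochhammer M n / fact n" and "N = real n"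
    have T0: "ultra_coeff \<mu> n 0 = q" "ultra_coeff \<mu> (n + 1) 0 = q * (M + N) / (N + 1)"
      "ultra_coeff \<mu> (n + 2) 0 = q * (M + N) * (M + N + 1) / ((N + 1) * (N + 2))"
      by (simp_all add: T p1 q_def N_def numeral_2_eq_2 mult_ac add_ac)
    have "N + 1 \<noteq> 0" "N + 2 \<noteq> 0" by (simp_all add: N_def)
    hence "(N + 2) * (q * (M + N) * (M + N + 1) / ((N + 1) * (N + 2))) + (N + M) * q
       = 2 * (N + 1 + M / 2) * (q * (M + N) / (N + 1))"
      by (simp add: divide_simps) (simp add: algebra_simps)
    moreover have "real (n + 2) = N + 2" "real n = N" by (simp_all add: N_def)
    ultimately show ?thesis unfolding 0 T0 by (simp only: goal_simps)
  next
    case (Suc j)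
    have goal_simps: "2 * \<mu> = M" "\<And>x. x + \<mu> = x + M / 2" "(k = 0) = False"
        "\<And>x y. (if False then x else y :: real) = y" "\<And>x. 0 - x = - (x :: real)" "\<And>x. - (2 * x) = - 2 * (x :: real)"
        "\<And>x. x * 0 = (0 :: real)" "\<And>x. x + 0 = (x :: real)"
      by (simp_all add: M(1) Suc)
    have cj: "c + real j = (M + 1 + 2 * real j) / 2" by (simp add: M)
    have pk: "pochhammer c (Suc j) = pochhammer c j * ((M + 1 + 2 * real j) / 2)"
      by (simp add: pochhammer_Suc cj)
    have fk: "fact (Suc j) = (real j + 1) * fact j" by (simp add: add.commute)
    consider "Suc j \<le> n" | "n = j" | "j = n + 1" | "j > n + 1" by linarith
    thus ?thesis
    proof cases
      case le: 1
      define i where "i = n - Suc j"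
      have 1: "n = i + Suc j" using le by (simp add: i_def)
      define q where "q = (- 1) ^ j * pochhammer M (n + k) / (pochhammer c j * fact j * fact i)"
      define I J D where "I = real i" and "J = real j" and "D = M + 1 + 2 * J"
      have nz: "I + 1 \<noteq> 0" "I + 2 \<noteq> 0" "J + 1 \<noteq> 0" "D \<noteq> 0"
        using c_add[of j] by (simp_all add: I_def J_def D_def)
      have MD: "M = D - 1 - 2 * J" by (simp add: D_def)
      have T1: "ultra_coeff \<mu> n k = - q / (D / 2 * (J + 1))"
        "ultra_coeff \<mu> (n + 1) k = - q * (D + I + 1) / (D / 2 * (J + 1) * (I + 1))"
        "ultra_coeff \<mu> (n + 2) k = - q * (D + I + 1) * (D + I + 2) / (D / 2 * (J + 1) * (I + 1) * (I + 2))"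
        "ultra_coeff \<mu> (n + 1) (k - 1) = q / ((I + 1) * (I + 2))"
      proof -
        have p: "pochhammer M (n + 1 + k) = pochhammer M (n + k) * (D + I + 1)"
          "pochhammer M (n + 2 + k) = pochhammer M (n + k) * (D + I + 1) * (D + I + 2)"
          using p1[of "n + k"] p1[of "Suc (n + k)"] by (simp_all add: Suc 1 D_def I_def J_def add_ac)
        have f: "fact (n + 1 - k) = (I + 1) * fact i" "fact (n + 2 - k) = (I + 2) * ((I + 1) * fact i)"
          "n - k = i" "n + 1 - j = n + 2 - k" "n + 1 + j = n + k" "k - 1 = j"
          by (simp_all add: Suc 1 I_def add_ac)
        have le: "k \<le> n" "k \<le> n + 1" "k \<le> n + 2" "j \<le> n + 1" using Suc 1 by auto
        have k: "pochhammer c k = pochhammer c j * (D / 2)" "fact k = (J + 1) * fact j" "(- 1 :: real) ^ k = - ((- 1) ^ j)"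
          unfolding Suc pk fk by (simp_all add: D_def J_def)
        show "ultra_coeff \<mu> n k = - q / (D / 2 * (J + 1))"
          "ultra_coeff \<mu> (n + 1) k = - q * (D + I + 1) / (D / 2 * (J + 1) * (I + 1))"
          "ultra_coeff \<mu> (n + 2) k = - q * (D + I + 1) * (D + I + 2) / (D / 2 * (J + 1) * (I + 1) * (I + 2))"
          "ultra_coeff \<mu> (n + 1) (k - 1) = q / ((I + 1) * (I + 2))"
          unfolding T f p k q_def using le by (simp_all add: mult_ac)
      qed
      have "(I + J + 1 + 2) * (- q * (D + I + 1) * (D + I + 2) / (D / 2 * (J + 1) * (I + 1) * (I + 2)))
          + (I + J + 1 + M) * (- q / (D / 2 * (J + 1)))
        = 2 * (I + J + 1 + 1 + M / 2) * (- q * (D + I + 1) / (D / 2 * (J + 1) * (I + 1)) - 2 * (q / ((I + 1) * (I + 2))))"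
        unfolding MD using nz by (simp add: divide_simps) (simp add: algebra_simps)
      moreover have "real (n + 2) = I + J + 1 + 2" "real n = I + J + 1" by (simp_all add: 1 I_def J_def)
      ultimately show ?thesis unfolding T1 by (simp only: goal_simps)
    next
      case 2
      define q where "q = (- 1) ^ j * pochhammer M (2 * n + 1) / (pochhammer c j * fact j)"
      define J D where "J = real j" and "D = M + 1 + 2 * J"
      have nz: "J + 1 \<noteq> 0" "D \<noteq> 0" using c_add[of j] by (simp_all add: J_def D_def)
      have MD: "M = D - 1 - 2 * J" by (simp add: D_def)
      have T1: "ultra_coeff \<mu> n k = 0"
        "ultra_coeff \<mu> (n + 1) k = - q * D / (D / 2 * (J + 1))"
        "ultra_coeff \<mu> (n + 2) k = - q * D * (D + 1) / (D / 2 * (J + 1))"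
        "ultra_coeff \<mu> (n + 1) (k - 1) = q"
      proof -
        have p: "pochhammer M (n + 1 + k) = pochhammer M (2 * n + 1) * D"
          "pochhammer M (n + 2 + k) = pochhammer M (2 * n + 1) * D * (D + 1)"
        proof -
          have ix: "n + 1 + k = Suc (2 * n + 1)" "n + 2 + k = Suc (Suc (2 * n + 1))" using Suc 2 by auto
          have D: "M + real (2 * n + 1) = D" "M + real (Suc (2 * n + 1)) = D + 1" by (simp_all add: 2 D_def J_def)
          show "pochhammer M (n + 1 + k) = pochhammer M (2 * n + 1) * D"
            "pochhammer M (n + 2 + k) = pochhammer M (2 * n + 1) * D * (D + 1)"
            unfolding ix p1[of "Suc (2 * n + 1)"] p1[of "2 * n + 1"] D by (rule refl)+
        qed
        have f: "n + 1 - k = 0" "n + 2 - k = 1" "n + 1 - j = 1" "n + 1 + j = 2 * n + 1" "k - 1 = j"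
          by (simp_all add: Suc 2)
        have le: "\<not> k \<le> n" "k \<le> n + 1" "k \<le> n + 2" "j \<le> n + 1" using Suc 2 by auto
        have k: "pochhammer c k = pochhammer c j * (D / 2)" "fact k = (J + 1) * fact j" "(- 1 :: real) ^ k = - ((- 1) ^ j)"
          unfolding Suc pk fk by (simp_all add: D_def J_def)
        show "ultra_coeff \<mu> n k = 0"
          "ultra_coeff \<mu> (n + 1) k = - q * D / (D / 2 * (J + 1))"
          "ultra_coeff \<mu> (n + 2) k = - q * D * (D + 1) / (D / 2 * (J + 1))"
          "ultra_coeff \<mu> (n + 1) (k - 1) = q"
          unfolding T f p k q_def using le by (simp_all add: mult_ac)
      qed
      have "(J + 2) * (- q * D * (D + 1) / (D / 2 * (J + 1)))
        = 2 * (J + 1 + M / 2) * (- q * D / (D / 2 * (J + 1)) - 2 * q)"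
        unfolding MD using nz by (simp add: divide_simps) (simp add: algebra_simps)
      moreover have "real (n + 2) = J + 2" "real n = J" by (simp_all add: 2 J_def)
      ultimately show ?thesis unfolding T1 by (simp only: goal_simps)
    next
      case 3
      define q where "q = (- 1) ^ j * pochhammer M (2 * j) / (pochhammer c j * fact j)"
      define J D where "J = real j" and "D = M + 1 + 2 * J"
      have nz: "J + 1 \<noteq> 0" "D \<noteq> 0" using c_add[of j] by (simp_all add: J_def D_def)
      have MD: "M = D - 1 - 2 * J" by (simp add: D_def)
      have T1: "ultra_coeff \<mu> n k = 0" "ultra_coeff \<mu> (n + 1) k = 0"
        "ultra_coeff \<mu> (n + 2) k = - q * (D - 1) * D / (D / 2 * (J + 1))"
        "ultra_coeff \<mu> (n + 1) (k - 1) = q"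
      proof -
        have p: "pochhammer M (n + 2 + k) = pochhammer M (2 * j) * (D - 1) * D"
        proof -
          have ix: "n + 2 + k = Suc (Suc (2 * j))" using Suc 3 by auto
          have D: "M + real (2 * j) = D - 1" "M + real (Suc (2 * j)) = D" by (simp_all add: D_def J_def)
          show ?thesis unfolding ix p1[of "Suc (2 * j)"] p1[of "2 * j"] D by (rule refl)
        qed
        have f: "n + 2 - k = 0" "n + 1 - j = 0" "n + 1 + j = 2 * j" "k - 1 = j"
          by (simp_all add: Suc 3)
        have le: "\<not> k \<le> n" "\<not> k \<le> n + 1" "k \<le> n + 2" "j \<le> n + 1" using Suc 3 by auto
        have k: "pochhammer c k = pochhammer c j * (D / 2)" "fact k = (J + 1) * fact j" "(- 1 :: real) ^ k = - ((- 1) ^ j)"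
          unfolding Suc pk fk by (simp_all add: D_def J_def)
        show "ultra_coeff \<mu> n k = 0" "ultra_coeff \<mu> (n + 1) k = 0"
          "ultra_coeff \<mu> (n + 2) k = - q * (D - 1) * D / (D / 2 * (J + 1))"
          "ultra_coeff \<mu> (n + 1) (k - 1) = q"
          unfolding T f p k q_def using le by (simp_all add: mult_ac)
      qed
      have "(J - 1 + 2) * (- q * (D - 1) * D / (D / 2 * (J + 1))) = 2 * (J - 1 + 1 + M / 2) * (- 2 * q)"
        unfolding MD using nz by (simp add: divide_simps) (simp add: algebra_simps)
      moreover have "real (n + 2) = J - 1 + 2" "real n = J - 1" by (simp_all add: 3 J_def)
      ultimately show ?thesis unfolding T1 by (simp only: goal_simps)
    next
      case 4
      thus ?thesis by (simp add: T Suc)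
    qed
  qed
qed

lemma ultra_rec:
  assumes \<mu>: "\<mu> > - 1 / 2"
  shows "real (n + 2) * ultra \<mu> (n + 2) x =
     2 * (real n + 1 + \<mu>) * x * ultra \<mu> (n + 1) x - (real n + 2 * \<mu>) * ultra \<mu> n x"
proof -
  define y where "y = (1 - x) / 2"
  let ?T = "ultra_coeff \<mu>"
  have x: "x = 1 - 2 * y" by (simp add: y_def field_simps)
  have U: "ultra \<mu> m x = (\<Sum>k\<le>n + 2. ?T m k * y ^ k)" if "m \<le> n + 2" for m
    unfolding y_def by (rule ultra_eq_sum_coeff[OF that])
  have yU: "y * ultra \<mu> (n + 1) x = (\<Sum>k\<le>n + 2. (if k = 0 then 0 else ?T (n + 1) (k - 1)) * y ^ k)"
  proof -
    have "(\<Sum>k\<le>n + 2. (if k = 0 then 0 else ?T (n + 1) (k - 1)) * y ^ k)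
       = (\<Sum>k\<le>n + 1. ?T (n + 1) k * y ^ Suc k)"
      using sum.atMost_Suc_shift[of "\<lambda>k. (if k = 0 then 0 else ?T (n + 1) (k - 1)) * y ^ k" "n + 1"] by simp
    also have "\<dots> = y * ultra \<mu> (n + 1) x"
      unfolding ultra_eq_sum_coeff[OF order.refl] y_def[symmetric] by (simp only: sum_distrib_left power_Suc mult_ac)
    finally show ?thesis ..
  qed
  have "real (n + 2) * ultra \<mu> (n + 2) x + (real n + 2 * \<mu>) * ultra \<mu> n x =
     (\<Sum>k\<le>n + 2. (real (n + 2) * ?T (n + 2) k + (real n + 2 * \<mu>) * ?T n k) * y ^ k)"
    by (simp add: U sum_distrib_left sum.distrib ring_distribs mult_ac)
  also have "\<dots> = 2 * (real n + 1 + \<mu>) * ((\<Sum>k\<le>n + 2. ?T (n + 1) k * y ^ k)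
       - 2 * (\<Sum>k\<le>n + 2. (if k = 0 then 0 else ?T (n + 1) (k - 1)) * y ^ k))"
    unfolding ultra_coeff_rec[OF \<mu>] sum_distrib_left sum_subtractf[symmetric]
    by (intro sum.cong refl) (auto simp: algebra_simps)
  also have "\<dots> = 2 * (real n + 1 + \<mu>) * (ultra \<mu> (n + 1) x - 2 * (y * ultra \<mu> (n + 1) x))"
    unfolding yU by (simp add: U)
  finally show ?thesis unfolding x by (simp add: algebra_simps)
qed

lemma ultra_0: "ultra \<mu> 0 x = 1" and ultra_1: "\<mu> > - 1 / 2 \<Longrightarrow> ultra \<mu> (Suc 0) x = 2 * \<mu> * x"
proof -
  show "ultra \<mu> 0 x = 1" by (simp add: ultra_def)
  assume "\<mu> > - 1 / 2"
  hence "1 + \<mu> * 2 \<noteq> 0" by linarith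
  thus "ultra \<mu> (Suc 0) x = 2 * \<mu> * x"
    by (simp add: ultra_def numeral_2_eq_2 pochhammer_Suc) (simp add: field_simps)
qed

text \<open>
  The value at \<open>1\<close> of the trigonometric expansion with absolute values on its coefficients.
\<close>

definition ultra_bound :: "real \<Rightarrow> nat \<Rightarrow> real" where
  "ultra_bound \<mu> n = (\<Sum>k\<le>n. \<bar>pochhammer \<mu> k / fact k\<bar> * \<bar>pochhammer \<mu> (n - k) / fact (n - k)\<bar>)"

text \<open>
  The binomial series of \<open>(1 - z X)\<close> to the power \<open>-\<mu>\<close>.
\<close>

definition binomial_gen_fps :: "complex \<Rightarrow> complex \<Rightarrow> complex fps" where
  "binomial_gen_fps \<mu> z = Abs_fps (\<lambda>k. pochhammer \<mu> k / fact k * z ^ k)"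

lemma binomial_gen_fps_ode: "(1 - fps_const z * fps_X) * fps_deriv (binomial_gen_fps \<mu> z) = fps_const (\<mu> * z) * binomial_gen_fps \<mu> z"
proof (rule fps_ext)
  fix n
  have "((1 - fps_const z * fps_X) * fps_deriv (binomial_gen_fps \<mu> z)) $ n
     = of_nat (Suc n) * binomial_gen_fps \<mu> z $ Suc n - z * (of_nat n * binomial_gen_fps \<mu> z $ n)"
    by (cases n) (simp_all add: left_diff_distrib mult.assoc)
  also have "of_nat (Suc n) * binomial_gen_fps \<mu> z $ Suc n = (\<mu> + of_nat n) * z * binomial_gen_fps \<mu> z $ n"
    by (simp add: binomial_gen_fps_def pochhammer_Suc divide_simps del: of_nat_Suc)
  finally show "((1 - fps_const z * fps_X) * fps_deriv (binomial_gen_fps \<mu> z)) $ n = (fps_const (\<mu> * z) * binomial_gen_fps \<mu> z) $ n"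
    by (simp add: algebra_simps)
qed

text \<open>
  The generating function \<open>(1 - 2 x X + X^2)\<close> to the power \<open>-\<mu>\<close> factors over the unit circle. Its
  logarithmic derivative yields the three-term recurrence of the Gegenbauer polynomials, and the first
  two coefficients agree.
\<close>

lemma ultra_trig:
  assumes \<mu>: "\<mu> > - 1 / 2"
  shows "complex_of_real (ultra \<mu> n (cos \<phi>)) = (binomial_gen_fps (of_real \<mu>) (cis \<phi>) * binomial_gen_fps (of_real \<mu>) (cis (- \<phi>))) $ n"
proof -
  define z w where "z = cis \<phi>" and "w = cis (- \<phi>)"
  define A B where "A = binomial_gen_fps (of_real \<mu>) z" and "B = binomial_gen_fps (of_real \<mu>) w"
  define P where "P = A * B"
  define M where "M = fps_const (complex_of_real \<mu>)"
  define Z V where "Z = fps_const z" and "V = fps_const w"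
  define x where "x = complex_of_real (cos \<phi>)"
  have zw: "z * w = 1" by (simp add: z_def w_def cis_mult)
  have zpw: "z + w = 2 * x" by (simp add: z_def w_def x_def complex_eq_iff)
  have ZV: "Z * V = 1" "Z + V = fps_const (2 * x)"
    by (simp_all add: Z_def V_def zw zpw)
  have A: "(1 - Z * fps_X) * fps_deriv A = M * Z * A" and B: "(1 - V * fps_X) * fps_deriv B = M * V * B"
    using binomial_gen_fps_ode[of z "of_real \<mu>"] binomial_gen_fps_ode[of w "of_real \<mu>"] by (simp_all add: A_def B_def M_def Z_def V_def)
  have "((1 - Z * fps_X) * (1 - V * fps_X)) * fps_deriv P =
     (1 - V * fps_X) * ((1 - Z * fps_X) * fps_deriv A) * B + (1 - Z * fps_X) * ((1 - V * fps_X) * fps_deriv B) * A"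
    by (simp add: P_def algebra_simps)
  also have "\<dots> = M * ((Z + V) - 2 * (Z * V) * fps_X) * P"
    unfolding A B P_def by (simp add: algebra_simps)
  also have "(1 - Z * fps_X) * (1 - V * fps_X) = 1 - (Z + V) * fps_X + (Z * V) * (fps_X * fps_X)"
    by (simp add: algebra_simps)
  finally have ode: "fps_deriv P - fps_const (2 * x) * (fps_X * fps_deriv P) + fps_X * (fps_X * fps_deriv P)
      = fps_const (of_real \<mu> * (2 * x)) * P - fps_const (2 * of_real \<mu>) * (fps_X * P)"
    unfolding ZV by (simp add: M_def algebra_simps flip: fps_const_mult) (simp add: fps_numeral_fps_const mult_ac)
  have P0: "P $ 0 = 1" by (simp add: P_def A_def B_def binomial_gen_fps_def)
  have P1: "P $ Suc 0 = 2 * of_real \<mu> * x"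
    using arg_cong[OF ode, of "\<lambda>F. F $ 0"] P0 by simp
  have rec: "of_nat (n + 2) * P $ (n + 2) = 2 * (of_nat n + 1 + of_real \<mu>) * x * P $ (n + 1) - (of_nat n + 2 * of_real \<mu>) * P $ n" for n
    using arg_cong[OF ode, of "\<lambda>F. F $ Suc n"] by (cases n) (simp_all add: algebra_simps)
  have "complex_of_real (ultra \<mu> n (cos \<phi>)) = P $ n \<and> complex_of_real (ultra \<mu> (Suc n) (cos \<phi>)) = P $ Suc n" for n
  proof (induction n)
    case 0
    show ?case using \<mu> by (simp add: ultra_0 ultra_1 P0 P1 x_def)
  next
    case (Suc n)
    have "of_nat (n + 2) * complex_of_real (ultra \<mu> (n + 2) (cos \<phi>)) =
      complex_of_real (real (n + 2) * ultra \<mu> (n + 2) (cos \<phi>))" by simp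
    also have "\<dots> = 2 * (of_nat n + 1 + of_real \<mu>) * x * complex_of_real (ultra \<mu> (n + 1) (cos \<phi>))
        - (of_nat n + 2 * of_real \<mu>) * complex_of_real (ultra \<mu> n (cos \<phi>))"
      unfolding ultra_rec[OF \<mu>] by (simp add: x_def)
    also have "\<dots> = of_nat (n + 2) * P $ (n + 2)" unfolding rec using Suc by simp
    finally have "complex_of_real (ultra \<mu> (n + 2) (cos \<phi>)) = P $ (n + 2)"
      using of_nat_neq_0[of "Suc n", where 'a = complex] by (simp del: of_nat_Suc)
    thus ?case using Suc by simp
  qed
  thus ?thesis by (simp add: P_def A_def B_def z_def w_def)
qed

text \<open>
  In the trigonometric form every summand is a product of two coefficients and a number of modulus 1.
  The expansion in powers of \<open>1 - x\<close> would only give a bound growing exponentially in \<open>n\<close>, too weak for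
  all radii below \<open>1\<close>.
\<close>

lemma abs_ultra_le:
  assumes \<mu>: "\<mu> > - 1 / 2" and x: "-1 \<le> x" "x \<le> 1"
  shows "\<bar>ultra \<mu> n x\<bar> \<le> ultra_bound \<mu> n"
proof -
  have "\<bar>ultra \<mu> n x\<bar> = norm (complex_of_real (ultra \<mu> n (cos (arccos x))))" using x by (simp add: cos_arccos)
  also have "\<dots> \<le> (\<Sum>k\<le>n. norm (binomial_gen_fps (of_real \<mu>) (cis (arccos x)) $ k * binomial_gen_fps (of_real \<mu>) (cis (- arccos x)) $ (n - k)))"
    unfolding ultra_trig[OF \<mu>] fps_mult_nth atLeast0AtMost by (rule norm_sum)
  also have "\<dots> = ultra_bound \<mu> n"
    unfolding ultra_bound_def binomial_gen_fps_def
    by (intro sum.cong refl) (simp add: norm_mult norm_power norm_divide pochhammer_of_real abs_divide)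
  finally show ?thesis .
qed

lemma ultra_bound_summable:
  assumes r: "0 \<le> r" "r < 1"
  shows "summable (\<lambda>n. ultra_bound \<mu> n * r ^ n)"
proof -
  let ?b = "\<lambda>k. complex_of_real (pochhammer \<mu> k / fact k)"
  have "?b (Suc k) = (of_real \<mu> + of_nat k) / (1 + of_nat k) * ?b k" for k
    by (simp add: pochhammer_Suc field_simps)
  hence "norm (?b (Suc k)) \<le> norm ((of_real \<mu> + of_nat k) / (1 + of_nat k) :: complex) * norm (?b k)" for k
    by (simp only: norm_mult)
  from summable_ratio_limit_one[OF this norm_ratio_tendsto_1 r]
  have s: "summable (\<lambda>k. \<bar>pochhammer \<mu> k / fact k\<bar> * r ^ k)" by (simp only: norm_of_real)
  have "summable (\<lambda>n. \<Sum>k\<le>n. (\<bar>pochhammer \<mu> k / fact k\<bar> * r ^ k) * (\<bar>pochhammer \<mu> (n - k) / fact (n - k)\<bar> * r ^ (n - k)))"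
    by (rule summable_Cauchy_product) (use s r in \<open>simp_all add: abs_mult\<close>)
  also have "(\<lambda>n. \<Sum>k\<le>n. (\<bar>pochhammer \<mu> k / fact k\<bar> * r ^ k) * (\<bar>pochhammer \<mu> (n - k) / fact (n - k)\<bar> * r ^ (n - k)))
     = (\<lambda>n. ultra_bound \<mu> n * r ^ n)"
    unfolding ultra_bound_def sum_distrib_right
  proof (intro ext sum.cong refl, goal_cases)
    case (1 n k)
    hence "r ^ n = r ^ k * r ^ (n - k)" by (simp flip: power_add)
    thus ?case by (simp add: mult_ac)
  qed
  finally show ?thesis .
qed

section \<open>Orthogonality of Gegenbauer polynomials\<close>

lemma alternating_binomial_sum_Suc:
  fixes f :: "nat \<Rightarrow> real"
  shows "(\<Sum>j\<le>Suc n. (- 1) ^ j * real (Suc n choose j) * f j) =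
     (\<Sum>j\<le>n. (- 1) ^ j * real (n choose j) * (f j - f (Suc j)))"
proof -
  have "(\<Sum>j\<le>Suc n. (- 1) ^ j * real (Suc n choose j) * f j) =
     f 0 + (\<Sum>j\<le>n. (- 1) ^ Suc j * real (Suc n choose Suc j) * f (Suc j))"
    by (subst sum.atMost_Suc_shift) simp
  also have "(\<Sum>j\<le>n. (- 1) ^ Suc j * real (Suc n choose Suc j) * f (Suc j)) =
     (\<Sum>j\<le>n. (- 1) ^ Suc j * real (n choose Suc j) * f (Suc j)) - (\<Sum>j\<le>n. (- 1) ^ j * real (n choose j) * f (Suc j))"
    unfolding sum_subtractf[symmetric] by (intro sum.cong refl) (simp add: algebra_simps)
  also have "f 0 + ((\<Sum>j\<le>n. (- 1) ^ Suc j * real (n choose Suc j) * f (Suc j)) - (\<Sum>j\<le>n. (- 1) ^ j * real (n choose j) * f (Suc j)))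
     = (\<Sum>j\<le>Suc n. (- 1) ^ j * real (n choose j) * f j) - (\<Sum>j\<le>n. (- 1) ^ j * real (n choose j) * f (Suc j))"
    by (subst sum.atMost_Suc_shift) simp
  also have "\<dots> = (\<Sum>j\<le>n. (- 1) ^ j * real (n choose j) * (f j - f (Suc j)))"
    by (simp add: binomial_eq_0 right_diff_distrib sum_subtractf)
  finally show ?thesis .
qed

text \<open>
  An \<open>n\<close>-th finite difference of a monic polynomial of degree \<open>k\<close>; each difference lowers the index of
  the rising factorial by one.
\<close>

lemma alternating_pochhammer_sum:
  fixes c :: real
  assumes "k \<le> n"
  shows "(\<Sum>j\<le>n. (- 1) ^ j * real (n choose j) * pochhammer (c + real j) k) = (if k = n then (- 1) ^ n * fact n else 0)"
  using assms
proof (induction n arbitrary: c k)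
  case 0
  thus ?case by simp
next
  case (Suc n)
  show ?case
  proof (cases k)
    case 0
    thus ?thesis unfolding alternating_binomial_sum_Suc by simp
  next
    case (Suc m)
    have diff: "pochhammer (c + real j) (Suc m) - pochhammer (c + real (Suc j)) (Suc m)
       = - real (Suc m) * pochhammer ((c + 1) + real j) m" for j
      unfolding pochhammer_rec[of "c + real j"] pochhammer_Suc[of "c + real (Suc j)"]
      by (simp add: algebra_simps)
    have "(\<Sum>j\<le>Suc n. (- 1) ^ j * real (Suc n choose j) * pochhammer (c + real j) k) =
       - real (Suc m) * (\<Sum>j\<le>n. (- 1) ^ j * real (n choose j) * pochhammer ((c + 1) + real j) m)"
      unfolding alternating_binomial_sum_Suc Suc diff sum_distrib_left
      by (intro sum.cong refl) (simp only: mult_ac)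
    also have "\<dots> = (if k = Suc n then (- 1) ^ Suc n * fact (Suc n) else 0)"
      using Suc.prems Suc by (subst Suc.IH) (auto simp: algebra_simps)
    finally show ?thesis .
  qed
qed

text \<open>
  The indicator is part of the weight, so that all integrals run over the whole line.
\<close>

definition ultra_weight :: "real \<Rightarrow> real \<Rightarrow> real" where
  "ultra_weight \<mu> x = indicator {-1<..<1} x * (1 - x\<^sup>2) powr (\<mu> - 1 / 2)"

lemma has_bochner_integral_Beta:
  fixes a b :: real
  assumes "a > 0" "b > 0"
  shows "has_bochner_integral lborel (\<lambda>t. indicator {0<..<1} t * (t powr (a - 1) * (1 - t) powr (b - 1))) (Beta a b)"
proof (rule has_bochner_integral_nn_integral)
  let ?f = "\<lambda>t::real. indicator {0<..<1} t * (t powr (a - 1) * (1 - t) powr (b - 1))"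
  show m: "?f \<in> borel_measurable lborel" by measurable
  show "0 \<le> Beta a b" using assms by (simp add: Beta_def Gamma_real_pos less_imp_le)
  have "((\<lambda>t. t powr (a - 1) * (1 - t) powr (b - 1)) has_integral Beta a b) {0<..<1}"
    using has_integral_Beta_real[OF assms] by (simp add: has_integral_Icc_iff_Ioo)
  hence "((\<lambda>t. if t \<in> {0<..<1} then t powr (a - 1) * (1 - t) powr (b - 1) else 0) has_integral Beta a b) UNIV"
    by (simp only: has_integral_restrict_UNIV)
  also have "(\<lambda>t. if t \<in> {0<..<1} then t powr (a - 1) * (1 - t) powr (b - 1) else 0) = ?f"
    by (auto simp: fun_eq_iff indicator_def)
  finally show "(\<integral>\<^sup>+ t. ?f t \<partial>lborel) = ennreal (Beta a b)"
    by (intro nn_integral_has_integral_lborel) (auto simp: m)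
qed (auto simp: indicator_def)

lemma has_bochner_integral_ultra_weight:
  assumes \<mu>: "\<mu> > - 1 / 2"
  shows "has_bochner_integral lborel
     (\<lambda>x. ultra_weight \<mu> x * (((1 - x) / 2) ^ i * ((1 + x) / 2) ^ j))
     (2 powr (2 * \<mu>) * Beta (\<mu> + 1 / 2 + real i) (\<mu> + 1 / 2 + real j))"
proof -
  let ?c = "\<mu> + 1 / 2"
  let ?f = "\<lambda>t. indicator {0<..<1} t * (t powr (?c + real i - 1) * (1 - t) powr (?c + real j - 1))"
  have "has_bochner_integral lborel ?f (Beta (?c + real i) (?c + real j))"
    using \<mu> by (intro has_bochner_integral_Beta) auto
  hence "has_bochner_integral lborel (\<lambda>x. ?f (1 / 2 + (- 1 / 2) * x)) (Beta (?c + real i) (?c + real j) /\<^sub>R \<bar>- 1 / 2\<bar>)"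
    by (subst (asm) lborel_has_bochner_integral_real_affine_iff[where t = "1 / 2" and c = "- 1 / 2"]) auto
  hence "has_bochner_integral lborel (\<lambda>x. 2 powr (2 * \<mu> - 1) * ?f (1 / 2 + (- 1 / 2) * x))
      (2 powr (2 * \<mu> - 1) * (Beta (?c + real i) (?c + real j) /\<^sub>R \<bar>- 1 / 2\<bar>))"
    by (rule has_bochner_integral_mult_right)
  also have "2 powr (2 * \<mu> - 1) * (Beta (?c + real i) (?c + real j) /\<^sub>R \<bar>- 1 / 2\<bar>) =
     2 powr (2 * \<mu>) * Beta (?c + real i) (?c + real j)"
    by (simp add: powr_diff)
  also have "(\<lambda>x. 2 powr (2 * \<mu> - 1) * ?f (1 / 2 + (- 1 / 2) * x)) =
     (\<lambda>x. ultra_weight \<mu> x * (((1 - x) / 2) ^ i * ((1 + x) / 2) ^ j))"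
  proof
    fix x :: real
    have e: "1 / 2 + (- 1 / 2) * x = (1 - x) / 2" "1 - (1 - x) / 2 = (1 + x) / 2" by (simp_all add: field_simps)
    show "2 powr (2 * \<mu> - 1) * ?f (1 / 2 + (- 1 / 2) * x) = ultra_weight \<mu> x * (((1 - x) / 2) ^ i * ((1 + x) / 2) ^ j)"
    proof (cases "x \<in> {-1<..<1}")
      case True
      define p q where "p = (1 - x) / 2" and "q = (1 + x) / 2"
      have pq: "p > 0" "q > 0" using True by (auto simp: p_def q_def)
      have "1 - x\<^sup>2 = 2 powr 2 * (p * q)" by (simp add: p_def q_def power2_eq_square field_simps)
      hence "(1 - x\<^sup>2) powr (\<mu> - 1 / 2) = 2 powr (2 * \<mu> - 1) * (p powr (\<mu> - 1 / 2) * q powr (\<mu> - 1 / 2))"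
      proof -
        have e': "2 * (\<mu> - 1 / 2) = 2 * \<mu> - 1" by simp
        show ?thesis
          unfolding \<open>1 - x\<^sup>2 = _\<close> using pq by (simp only: powr_mult powr_powr e')
      qed
      moreover have "p powr (?c + real i - 1) = p powr (\<mu> - 1 / 2) * p ^ i" "q powr (?c + real j - 1) = q powr (\<mu> - 1 / 2) * q ^ j"
        using pq by (simp_all flip: powr_add powr_realpow add: algebra_simps)
      moreover have "p \<in> {0<..<1}" using True by (auto simp: p_def)
      moreover have "1 - p = q" by (simp add: p_def q_def field_simps)
      ultimately show ?thesis
        unfolding e(1) ultra_weight_def p_def[symmetric] q_def[symmetric] using True by simp
    next
      case False
      thus ?thesis unfolding e ultra_weight_def by (auto simp: indicator_def)
    qed
  qed
  finally show ?thesis .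
qed

text \<open>
  Every summand of the form is a Beta integral, and the rising factorials in its denominators cancel
  against the Gamma functions of the Beta values. What remains is an alternating binomial sum, hence \<open>0\<close>
  for \<open>k < n\<close>.
\<close>

lemma has_bochner_integral_jacobi_form:
  assumes \<mu>: "\<mu> > - 1 / 2" and k: "k \<le> n"
  shows "has_bochner_integral lborel
     (\<lambda>x. ultra_weight \<mu> x * (((1 - x) / 2) ^ k * jacobi_form (\<mu> + 1 / 2) n ((1 - x) / 2)))
     (if k = n then (- 1) ^ n * 2 powr (2 * \<mu>) * (Gamma (\<mu> + 1 / 2))\<^sup>2 / Gamma (2 * \<mu> + 1 + 2 * real n) else 0)"
proof -
  define c where "c = \<mu> + 1 / 2"
  have c: "c > 0" using \<mu> by (simp add: c_def)
  have pc: "pochhammer c m \<noteq> 0" for m using pochhammer_pos[OF c, of m] by simp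
  define e where "e = (\<lambda>j. (- 1) ^ j / (pochhammer c j * fact j * (pochhammer c (n - j) * fact (n - j))))"
  have "has_bochner_integral lborel
     (\<lambda>x. \<Sum>j\<le>n. e j * (ultra_weight \<mu> x * (((1 - x) / 2) ^ (k + j) * ((1 + x) / 2) ^ (n - j))))
     (\<Sum>j\<le>n. e j * (2 powr (2 * \<mu>) * Beta (c + real (k + j)) (c + real (n - j))))"
    unfolding c_def
    by (intro has_bochner_integral_sum has_bochner_integral_mult_right has_bochner_integral_ultra_weight \<mu>)
  also have "(\<lambda>x. \<Sum>j\<le>n. e j * (ultra_weight \<mu> x * (((1 - x) / 2) ^ (k + j) * ((1 + x) / 2) ^ (n - j)))) =
     (\<lambda>x. ultra_weight \<mu> x * (((1 - x) / 2) ^ k * jacobi_form c n ((1 - x) / 2)))"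
  proof
    fix x :: real
    have q: "1 - (1 - x) / 2 = (1 + x) / 2" by (simp add: field_simps)
    show "(\<Sum>j\<le>n. e j * (ultra_weight \<mu> x * (((1 - x) / 2) ^ (k + j) * ((1 + x) / 2) ^ (n - j)))) =
      ultra_weight \<mu> x * (((1 - x) / 2) ^ k * jacobi_form c n ((1 - x) / 2))"
      unfolding jacobi_form_def q sum_distrib_left e_def power_minus[of "(1 - x) / 2"] power_add
      by (intro sum.cong refl) (simp add: mult_ac)
  qed
  also have "(\<Sum>j\<le>n. e j * (2 powr (2 * \<mu>) * Beta (c + real (k + j)) (c + real (n - j)))) =
     2 powr (2 * \<mu>) * (Gamma c)\<^sup>2 / (fact n * Gamma (2 * c + real n + real k)) *
     (\<Sum>j\<le>n. (- 1) ^ j * real (n choose j) * pochhammer (c + real j) k)"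
    unfolding sum_distrib_left
  proof (intro sum.cong refl)
    fix j assume "j \<in> {..n}"
    hence j: "j \<le> n" by simp
    have G: "Gamma (c + real m) = pochhammer c m * Gamma c" for m
      using c by (subst pochhammer_Gamma) (auto simp: Gamma_eq_zero_iff elim!: nonpos_Ints_cases')
    have "Beta (c + real (k + j)) (c + real (n - j)) =
      pochhammer c (j + k) * pochhammer c (n - j) * (Gamma c)\<^sup>2 / Gamma (2 * c + real n + real k)"
      unfolding Beta_def G using j by (simp add: power2_eq_square of_nat_diff algebra_simps)
    also have "pochhammer c (j + k) = pochhammer c j * pochhammer (c + real j) k"
      by (rule pochhammer_product')
    finally show "e j * (2 powr (2 * \<mu>) * Beta (c + real (k + j)) (c + real (n - j))) =
      2 powr (2 * \<mu>) * (Gamma c)\<^sup>2 / (fact n * Gamma (2 * c + real n + real k)) *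
      ((- 1) ^ j * real (n choose j) * pochhammer (c + real j) k)"
      using pc[of j] pc[of "n - j"] j by (simp add: e_def binomial_fact mult_ac)
  qed
  also have "\<dots> = (if k = n then (- 1) ^ n * 2 powr (2 * \<mu>) * (Gamma c)\<^sup>2 / Gamma (2 * \<mu> + 1 + 2 * real n) else 0)"
    unfolding alternating_pochhammer_sum[OF k] by (simp add: c_def algebra_simps)
  finally show ?thesis by (simp only: c_def)
qed

lemma two_mu_notin_nonpos_Ints:
  assumes "\<mu> > - 1 / 2" "\<mu> \<noteq> (0::real)"
  shows "2 * \<mu> \<notin> \<int>\<^sub>\<le>\<^sub>0"
proof
  assume "2 * \<mu> \<in> \<int>\<^sub>\<le>\<^sub>0"
  then obtain i where "2 * \<mu> = - real i" by (auto elim: nonpos_Ints_cases')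
  thus False using assms by (cases i) auto
qed

lemma two_mu_pochhammer_neq_0:
  assumes "\<mu> > - 1 / 2" "\<mu> \<noteq> (0::real)"
  shows "pochhammer (2 * \<mu>) n \<noteq> 0"
  using two_mu_notin_nonpos_Ints[OF assms] by (auto simp: pochhammer_eq_0_iff)

text \<open>
  The factor of larger degree is written as a form, the other one in powers of \<open>(1 - x) / 2\<close>; only the
  top power can contribute.
\<close>

lemma ultra_orthogonal_le:
  assumes \<mu>: "\<mu> > - 1 / 2" "\<mu> \<noteq> 0" and m: "m \<le> n"
  shows "has_bochner_integral lborel (\<lambda>x. ultra_weight \<mu> x * (ultra \<mu> m x * ultra \<mu> n x))
     (if m = n then pochhammer (2 * \<mu>) n * 2 powr (2 * \<mu> - 1) * (Gamma (\<mu> + 1 / 2))\<^sup>2 /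
        (fact n * (real n + \<mu>) * Gamma (2 * \<mu>)) else 0)"
proof -
  define c where "c = \<mu> + 1 / 2"
  have pc: "pochhammer c k > 0" for k using \<mu> by (intro pochhammer_pos) (simp add: c_def)
  define K where "K = pochhammer c n * pochhammer (2 * \<mu>) n"
  let ?v = "\<lambda>k. if k = n then (- 1) ^ n * 2 powr (2 * \<mu>) * (Gamma c)\<^sup>2 / Gamma (2 * \<mu> + 1 + 2 * real n) else 0"
  have "has_bochner_integral lborel
     (\<lambda>x. \<Sum>k\<le>m. (K * ultra_coeff \<mu> m k) * (ultra_weight \<mu> x * (((1 - x) / 2) ^ k * jacobi_form c n ((1 - x) / 2))))
     (\<Sum>k\<le>m. (K * ultra_coeff \<mu> m k) * ?v k)"
    unfolding c_def
    by (intro has_bochner_integral_sum has_bochner_integral_mult_right has_bochner_integral_jacobi_form \<mu>(1))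
       (use m in auto)
  also have "(\<lambda>x. \<Sum>k\<le>m. (K * ultra_coeff \<mu> m k) * (ultra_weight \<mu> x * (((1 - x) / 2) ^ k * jacobi_form c n ((1 - x) / 2))))
     = (\<lambda>x. ultra_weight \<mu> x * (ultra \<mu> m x * ultra \<mu> n x))"
    unfolding ultra_eq_jacobi_form[OF \<mu>(1), of n] ultra_eq_sum_coeff[OF order.refl[of m]] c_def[symmetric] K_def[symmetric]
    by (simp add: sum_distrib_left sum_distrib_right mult_ac)
  also have "(\<Sum>k\<le>m. (K * ultra_coeff \<mu> m k) * ?v k) = (if m = n then pochhammer (2 * \<mu>) n * 2 powr (2 * \<mu> - 1) * (Gamma c)\<^sup>2 /
        (fact n * (real n + \<mu>) * Gamma (2 * \<mu>)) else 0)"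
  proof (cases "m = n")
    case False
    thus ?thesis using m by (auto intro!: sum.neutral)
  next
    case True
    note nonint = two_mu_notin_nonpos_Ints[OF \<mu>]
    have nz: "Gamma (2 * \<mu>) \<noteq> 0" "pochhammer (2 * \<mu>) (2 * n) \<noteq> 0"
      using nonint by (auto simp: Gamma_eq_zero_iff pochhammer_eq_0_iff)
    have n\<mu>: "real n + \<mu> \<noteq> 0" using \<mu> by (cases n) auto
    have "Gamma (2 * \<mu> + 1 + 2 * real n) = pochhammer (2 * \<mu>) (Suc (2 * n)) * Gamma (2 * \<mu>)"
      using nonint nz by (subst pochhammer_Gamma) (auto simp: algebra_simps)
    also have "\<dots> = 2 * (real n + \<mu>) * pochhammer (2 * \<mu>) (2 * n) * Gamma (2 * \<mu>)"
      by (simp add: pochhammer_Suc algebra_simps)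
    finally have G: "Gamma (2 * \<mu> + 1 + 2 * real n) = 2 * (real n + \<mu>) * pochhammer (2 * \<mu>) (2 * n) * Gamma (2 * \<mu>)" .
    have T: "ultra_coeff \<mu> n n = (- 1) ^ n * pochhammer (2 * \<mu>) (2 * n) / (pochhammer c n * fact n)"
      by (simp add: ultra_coeff_def c_def flip: mult_2)
    have s: "(- 1) ^ n * (- 1) ^ n = (1 :: real)" by (simp flip: power_mult_distrib)
    have "(\<Sum>k\<le>m. (K * ultra_coeff \<mu> m k) * ?v k) = (K * ultra_coeff \<mu> n n) * ?v n"
      unfolding True by (subst sum.remove[of _ n]) (auto intro!: sum.neutral)
    also have "\<dots> = ((- 1) ^ n * (- 1) ^ n) * (pochhammer (2 * \<mu>) n * (2 powr (2 * \<mu>) / 2) * (Gamma c)\<^sup>2 /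
        (fact n * (real n + \<mu>) * Gamma (2 * \<mu>)))"
      unfolding K_def T G using pc[of n] nz n\<mu> by (simp add: divide_simps)
    finally show ?thesis using True by (simp add: s powr_diff)
  qed
  finally show ?thesis by (simp only: c_def)
qed

lemma ultra_orthogonal:
  assumes \<mu>: "\<mu> > - 1 / 2" "\<mu> \<noteq> 0"
  shows "has_bochner_integral lborel (\<lambda>x. ultra_weight \<mu> x * (ultra \<mu> m x * ultra \<mu> n x))
     (if m = n then pochhammer (2 * \<mu>) n * 2 powr (2 * \<mu> - 1) * (Gamma (\<mu> + 1 / 2))\<^sup>2 /
        (fact n * (real n + \<mu>) * Gamma (2 * \<mu>)) else 0)"
proof (cases "m \<le> n")
  case True
  thus ?thesis by (rule ultra_orthogonal_le[OF assms])
next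
  case False
  thus ?thesis using ultra_orthogonal_le[OF assms, of n m] by (simp add: mult_ac)
qed

section \<open>The product of Legendre functions\<close>

lemma ultra_bound_nonneg: "ultra_bound \<mu> n \<ge> 0"
  by (auto simp: ultra_bound_def intro!: sum_nonneg)

text \<open>
  The coefficients of Brafman's formula with respect to the Gegenbauer polynomials.
\<close>

definition brafman_coeff :: "real \<Rightarrow> complex \<Rightarrow> nat \<Rightarrow> complex" where
  "brafman_coeff \<mu> l n = pochhammer (2 * of_real \<mu> - l) n * pochhammer l n /
     (pochhammer (of_real \<mu> + 1 / 2) n * pochhammer (2 * of_real \<mu>) n)"

abbreviation brafman :: "real \<Rightarrow> complex \<Rightarrow> real \<Rightarrow> complex fps" where
  "brafman \<mu> l x \<equiv> brafman_fps (2 * of_real \<mu> - l) l (of_real \<mu> + 1 / 2) (of_real x)"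

lemma brafman_nth:
  assumes \<mu>: "\<mu> > - 1 / 2" "\<mu> \<noteq> 0"
  shows "fps_nth (brafman \<mu> l x) n = brafman_coeff \<mu> l n * of_real (ultra \<mu> n x)"
proof -
  define y where "y = (1 - x) / 2"
  define c where "c = \<mu> + 1 / 2"
  have x: "(complex_of_real x - 1) / 2 = of_real (- y)" "(complex_of_real x + 1) / 2 = of_real (1 - y)"
    "complex_of_real \<mu> + 1 / 2 = of_real c"
    by (simp_all add: y_def c_def field_simps)
  have pc: "pochhammer c n \<noteq> 0" using pochhammer_pos[of c n] \<mu> by (simp add: c_def)
  have p: "pochhammer (2 * complex_of_real \<mu>) n = of_real (pochhammer (2 * \<mu>) n)"
    using pochhammer_of_real[of "2 * \<mu>" n, where 'a = complex] by simp
  show ?thesis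
    unfolding brafman_fps_def brafman_coeff_def fps_nth_Abs_fps x f4_form_eq_jacobi_form
      ultra_eq_jacobi_form[OF \<mu>(1)] c_def[symmetric] y_def[symmetric] p pochhammer_of_real
    using pc two_mu_pochhammer_neq_0[OF \<mu>, of n] by simp
qed

text \<open>
  The coefficients have subexponential growth, and so have the bounds of the polynomials. Splitting
  \<open>r = s * s\<close> lets one factor \<open>s^n\<close> absorb the former and the other one the latter.
\<close>

lemma summable_brafman_bound:
  assumes r: "0 \<le> r" "r < 1"
  shows "summable (\<lambda>n. norm (brafman_coeff \<mu> l n) * ultra_bound \<mu> n * r ^ n)"
proof -
  define s where "s = sqrt r"
  have s: "0 \<le> s" "s < 1" using r by (auto simp: s_def)
  have q: "(\<lambda>n. norm ((2 * of_real \<mu> - l + of_nat n) / (of_real \<mu> + 1 / 2 + of_nat n)) *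
      norm ((l + of_nat n) / (2 * of_real \<mu> + of_nat n))) \<longlonglongrightarrow> 1"
    using tendsto_mult[OF norm_ratio_tendsto_1[of "2 * of_real \<mu> - l" "of_real \<mu> + 1 / 2"] norm_ratio_tendsto_1[of l "2 * of_real \<mu>"]]
    by simp
  have "summable (\<lambda>n. norm (brafman_coeff \<mu> l n) * s ^ n)"
    by (rule summable_ratio_limit_one[OF _ q s])
       (simp add: brafman_coeff_def pochhammer_Suc norm_mult norm_divide mult_ac)
  hence "(\<lambda>n. norm (brafman_coeff \<mu> l n) * s ^ n) \<longlonglongrightarrow> 0" by (rule summable_LIMSEQ_zero)
  hence "Bseq (\<lambda>n. norm (brafman_coeff \<mu> l n) * s ^ n)" by (intro convergent_imp_Bseq) (auto simp: convergent_def)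
  then obtain K where K: "\<And>n. norm (norm (brafman_coeff \<mu> l n) * s ^ n) \<le> K" by (auto simp: Bseq_def)
  note nonneg = ultra_bound_nonneg[of \<mu>]
  show ?thesis
  proof (rule summable_comparison_test')
    show "summable (\<lambda>n. K * (ultra_bound \<mu> n * s ^ n))"
      by (intro summable_mult ultra_bound_summable s)
    fix n
    have "r ^ n = s ^ n * s ^ n" using r by (simp add: s_def flip: power_mult_distrib)
    hence "norm (norm (brafman_coeff \<mu> l n) * ultra_bound \<mu> n * r ^ n) =
       norm (norm (brafman_coeff \<mu> l n) * s ^ n) * (ultra_bound \<mu> n * s ^ n)"
      using nonneg[of n] s by (simp add: abs_mult mult_ac)
    also have "\<dots> \<le> K * (ultra_bound \<mu> n * s ^ n)"
      using nonneg[of n] s by (intro mult_right_mono K) auto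
    finally show "norm (norm (brafman_coeff \<mu> l n) * ultra_bound \<mu> n * r ^ n) \<le> K * (ultra_bound \<mu> n * s ^ n)" .
  qed
qed

lemma fps_conv_radius_brafman:
  assumes \<mu>: "\<mu> > - 1 / 2" "\<mu> \<noteq> 0" and x: "-1 \<le> x" "x \<le> 1"
  shows "fps_conv_radius (brafman \<mu> l x) \<ge> 1"
proof -
  have "summable (\<lambda>n. fps_nth (brafman \<mu> l x) n * of_real r ^ n)" if "0 \<le> r" "r < 1" for r
  proof (rule summable_comparison_test'[OF summable_brafman_bound[OF that]])
    fix n
    show "norm (fps_nth (brafman \<mu> l x) n * of_real r ^ n) \<le> norm (brafman_coeff \<mu> l n) * ultra_bound \<mu> n * r ^ n"
      unfolding brafman_nth[OF \<mu>] norm_mult norm_power norm_of_real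
      using that by (intro mult_mono mult_left_mono abs_ultra_le \<mu> x) (simp_all add: ultra_bound_nonneg)
  qed
  thus ?thesis unfolding fps_conv_radius_def by (intro conv_radius_geI_ex') auto
qed

text \<open>
  The four linear factors \<open>R + \<rho> \<plusminus> 1\<close> and \<open>1 \<plusminus> (R - \<rho>)\<close> have product \<open>4 \<rho>^2 (1 - x^2)\<close>, and the
  powers in the two Legendre functions together with those from the Euler transformation combine to a
  power of this product. The inequalities show that the hypergeometric arguments stay in the unit disc.
\<close>

lemma legendre_prefactor:
  fixes x \<rho> e :: real
  assumes x: "-1 < x" "x < 1" and \<rho>: "0 < \<rho>" "\<rho> < 1"
  defines "R \<equiv> sqrt (1 + \<rho>\<^sup>2 - 2 * \<rho> * x)"
  shows "R + \<rho> > 1" "R - \<rho> < 1" "R + \<rho> < 1 + 2 * \<rho>" "R - \<rho> > 1 - 2 * \<rho>" "R - \<rho> > - 1"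
    "((R + \<rho> + 1) / (R + \<rho> - 1)) powr (- e / 2) * ((1 + R + \<rho>) / 2) powr e *
       (((1 + (R - \<rho>)) / (1 - (R - \<rho>))) powr (- e / 2) * ((1 + R - \<rho>) / 2) powr e)
     = (\<rho> / 2) powr e * (1 - x\<^sup>2) powr (e / 2)"
proof -
  have R2: "R\<^sup>2 = 1 + \<rho>\<^sup>2 - 2 * \<rho> * x" and R0: "R \<ge> 0"
    using sqrt_between(3)[OF x, of \<rho>] \<rho> by (simp_all add: R_def)
  have "\<rho> * x < \<rho> * 1" "\<rho> * (-1) < \<rho> * x"
    using x \<rho> by (intro mult_strict_left_mono; simp)+
  hence "(1 - \<rho>)\<^sup>2 < R\<^sup>2" "R\<^sup>2 < (1 + \<rho>)\<^sup>2" using x unfolding R2 by (auto simp: power2_eq_square algebra_simps)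
  hence lt: "1 - \<rho> < R" "R < 1 + \<rho>" using R0 \<rho> by (auto intro: power2_less_imp_less)
  thus "R + \<rho> > 1" "R - \<rho> < 1" "R + \<rho> < 1 + 2 * \<rho>" "R - \<rho> > 1 - 2 * \<rho>" "R - \<rho> > - 1" using \<rho> R0 by auto
  define A B C D where "A = R + \<rho> + 1" and "B = R + \<rho> - 1" and "C = 1 + (R - \<rho>)" and "D = 1 - (R - \<rho>)"
  have pos: "A > 0" "B > 0" "C > 0" "D > 0" using lt \<rho> R0 by (auto simp: A_def B_def C_def D_def)
  have AC: "A * C = (1 + R)\<^sup>2 - \<rho>\<^sup>2" and BD: "B * D = \<rho>\<^sup>2 - (R - 1)\<^sup>2"
    by (simp_all add: A_def B_def C_def D_def power2_eq_square algebra_simps)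
  have "A * C * (B * D) = 4 * (R\<^sup>2 - (1 - \<rho> * x)\<^sup>2)"
  proof -
    have ac: "A * C = 2 * (R + (1 - \<rho> * x))" and bd: "B * D = 2 * (R - (1 - \<rho> * x))"
      unfolding AC BD using R2 by (simp_all add: power2_eq_square algebra_simps)
    show ?thesis unfolding ac bd by (simp add: power2_eq_square algebra_simps)
  qed
  hence prod: "A * C * (B * D) / 16 = (\<rho> / 2)\<^sup>2 * (1 - x\<^sup>2)"
    unfolding R2 by (simp add: power2_eq_square algebra_simps)
  define h where "h = e / 2"
  have inv: "(X / Y) powr (- h) = (Y / X) powr h" if "X > 0" "Y > 0" for X Y :: real
    using that by (simp add: powr_minus powr_divide)
  have sq: "X powr e = (X\<^sup>2) powr h" if "X > 0" for X :: real
    using that by (simp add: h_def powr_powr flip: powr_numeral)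
  have "(A / B) powr (- h) * (A / 2) powr e * ((C / D) powr (- h) * (C / 2) powr e)
      = ((B / A) * (A / 2)\<^sup>2 * ((D / C) * (C / 2)\<^sup>2)) powr h"
    using pos by (simp only: inv sq powr_mult zero_less_divide_iff zero_less_numeral simp_thms)
  also have "(B / A) * (A / 2)\<^sup>2 * ((D / C) * (C / 2)\<^sup>2) = A * C * (B * D) / 16"
    using pos by (simp add: power2_eq_square field_simps)
  also have "(A * C * (B * D) / 16) powr h = (\<rho> / 2) powr e * (1 - x\<^sup>2) powr h"
    unfolding prod sq[of "\<rho> / 2", OF half_gt_zero[OF \<rho>(1)]] by (rule powr_mult)
  finally show "((R + \<rho> + 1) / (R + \<rho> - 1)) powr (- e / 2) * ((1 + R + \<rho>) / 2) powr e *
       (((1 + (R - \<rho>)) / (1 - (R - \<rho>))) powr (- e / 2) * ((1 + R - \<rho>) / 2) powr e)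
     = (\<rho> / 2) powr e * (1 - x\<^sup>2) powr (e / 2)"
    by (simp add: A_def B_def C_def D_def h_def algebra_simps)
qed

text \<open>
  Here \<open>a = 2\<mu> - \<lambda>\<close>, \<open>b = \<lambda>\<close>, \<open>c = \<mu> + 1/2\<close>, so \<open>2 c = a + b + 1\<close> as Brafman's formula requires.
\<close>

lemma legendre_ferrers_eq_brafman:
  assumes \<mu>: "\<mu> > - 1 / 2" "\<mu> \<noteq> 0" and x: "-1 < x" "x < 1" and \<rho>: "0 < \<rho>" "\<rho> < 1"
  shows "legendre_ferrers \<mu> l \<rho> x =
    of_real ((\<rho> / 2) powr (\<mu> - 1 / 2) * (1 - x\<^sup>2) powr (\<mu> / 2 - 1 / 4) / (Gamma (\<mu> + 1 / 2))\<^sup>2) *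
    eval_fps (brafman \<mu> l x) (of_real \<rho>)"
proof -
  define R where "R = sqrt (1 + \<rho>\<^sup>2 - 2 * \<rho> * x)"
  define e where "e = \<mu> - 1 / 2"
  define a b c where "a = 2 * of_real \<mu> - l" and "b = l" and "c = complex_of_real \<mu> + 1 / 2"
  note pre = legendre_prefactor[OF x \<rho>, folded R_def]
  have c: "Re c > 0" using \<mu> by (simp add: c_def)
  have hyp: "hyp2F1 (- (of_real (\<mu> - 1 / 2) - l)) (of_real (\<mu> - 1 / 2) - l + 1) (1 - of_real (1 / 2 - \<mu>)) (of_real z)
     = of_real ((1 - z) powr e) * eval_fps (hyp_fps a b c) (of_real z)" if z: "\<bar>z\<bar> < 1" for z
  proof -
    have n: "norm (complex_of_real z) < 1" using z by simp
    have "- (of_real (\<mu> - 1 / 2) - l) = c - a" "of_real (\<mu> - 1 / 2) - l + 1 = c - b" "1 - of_real (1 / 2 - \<mu>) = c"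
      by (simp_all add: a_def b_def c_def)
    hence "hyp2F1 (- (of_real (\<mu> - 1 / 2) - l)) (of_real (\<mu> - 1 / 2) - l + 1) (1 - of_real (1 / 2 - \<mu>)) (of_real z)
       = hyp2F1 (c - a) (c - b) c (of_real z)" by simp
    also have "\<dots> = (1 - of_real z) powr (c - (c - a) - (c - b)) * hyp2F1 (c - (c - a)) (c - (c - b)) c (of_real z)"
      by (rule hyp2F1_Euler[OF c n])
    also have "c - (c - a) - (c - b) = of_real e" by (simp add: a_def b_def c_def e_def)
    also have "(1 - complex_of_real z) powr of_real e = of_real ((1 - z) powr e)"
      using z powr_of_real[of "1 - z" e] by simp
    finally show ?thesis by (simp add: hyp2F1_eval_fps[OF n])
  qed
  have \<kappa>: "complex_of_real (1 / 2 - \<mu>) / 2 = of_real (- e / 2)" by (simp add: e_def)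
  have G: "Gamma (1 - complex_of_real (1 / 2 - \<mu>)) = of_real (Gamma (\<mu> + 1 / 2))"
    by (simp add: Gamma_complex_of_real[symmetric] add.commute)
  define z1 z2 where "z1 = (1 - R - \<rho>) / 2" and "z2 = (1 - R + \<rho>) / 2"
  have z: "\<bar>z1\<bar> < 1" "\<bar>z2\<bar> < 1" using pre(1-5) \<rho> unfolding z1_def z2_def by (auto simp: abs_less_iff field_simps)
  have L: "legendre_P (of_real (\<mu> - 1 / 2) - l) (of_real (1 / 2 - \<mu>)) (of_real (R + \<rho>)) =
     of_real (1 / Gamma (\<mu> + 1 / 2) * (((R + \<rho> + 1) / (R + \<rho> - 1)) powr (- e / 2) * ((1 + R + \<rho>) / 2) powr e)) *
     eval_fps (hyp_fps a b c) (of_real z1)"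
  proof -
    have "(complex_of_real (R + \<rho>) + 1) / (of_real (R + \<rho>) - 1) = of_real ((R + \<rho> + 1) / (R + \<rho> - 1))" by simp
    moreover have "complex_of_real ((R + \<rho> + 1) / (R + \<rho> - 1)) powr of_real (- e / 2) = of_real (((R + \<rho> + 1) / (R + \<rho> - 1)) powr (- e / 2))"
      by (rule powr_of_real) (use pre(1) in auto)
    moreover have "(1 - complex_of_real (R + \<rho>)) / 2 = of_real z1" by (simp add: z1_def)
    moreover have "1 - z1 = (1 + R + \<rho>) / 2" by (simp add: z1_def field_simps)
    ultimately show ?thesis
      unfolding legendre_P_def \<kappa> G by (simp only: hyp[OF z(1)]) simp
  qed
  have F: "ferrers_P (of_real (\<mu> - 1 / 2) - l) (of_real (1 / 2 - \<mu>)) (R - \<rho>) =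
     of_real (1 / Gamma (\<mu> + 1 / 2) * (((1 + (R - \<rho>)) / (1 - (R - \<rho>))) powr (- e / 2) * ((1 + R - \<rho>) / 2) powr e)) *
     eval_fps (hyp_fps a b c) (of_real z2)"
  proof -
    have "complex_of_real ((1 + (R - \<rho>)) / (1 - (R - \<rho>))) powr of_real (- e / 2) = of_real (((1 + (R - \<rho>)) / (1 - (R - \<rho>))) powr (- e / 2))"
      by (rule powr_of_real) (use pre(2,5) in auto)
    moreover have "(1 - (R - \<rho>)) / 2 = z2" by (simp add: z2_def)
    moreover have "1 - z2 = (1 + R - \<rho>) / 2" by (simp add: z2_def field_simps)
    ultimately show ?thesis
      unfolding ferrers_P_def \<kappa> G by (simp only: hyp[OF z(2)]) simp
  qed
  have "eval_fps (hyp_fps a b c) (of_real z1) * eval_fps (hyp_fps a b c) (of_real z2)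
      = eval_fps (brafman_fps a b c (of_real x)) (of_real \<rho>)"
    unfolding z1_def z2_def R_def
    by (rule Brafman[OF _ c x \<rho>])
       (use fps_conv_radius_brafman[OF \<mu>, of x l] x in \<open>auto simp: a_def b_def c_def\<close>)
  hence "legendre_ferrers \<mu> l \<rho> x =
     of_real (1 / (Gamma (\<mu> + 1 / 2))\<^sup>2 * (((R + \<rho> + 1) / (R + \<rho> - 1)) powr (- e / 2) * ((1 + R + \<rho>) / 2) powr e *
       (((1 + (R - \<rho>)) / (1 - (R - \<rho>))) powr (- e / 2) * ((1 + R - \<rho>) / 2) powr e))) *
     eval_fps (brafman_fps a b c (of_real x)) (of_real \<rho>)"
    unfolding legendre_ferrers_def Let_def R_def[symmetric] L F by (simp add: power2_eq_square mult_ac)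
  also have "\<dots> = of_real ((\<rho> / 2) powr e * (1 - x\<^sup>2) powr (e / 2) / (Gamma (\<mu> + 1 / 2))\<^sup>2) *
     eval_fps (brafman_fps a b c (of_real x)) (of_real \<rho>)"
    unfolding pre(6)[of e] by simp
  also have "e / 2 = \<mu> / 2 - 1 / 4" by (simp add: e_def)
  finally show ?thesis by (simp only: a_def b_def c_def e_def)
qed

section \<open>The integral\<close>

text \<open>
  The analytic extension in \<open>\<rho>\<close>: after multiplication by \<open>\<rho>\<close> to the power \<open>1/2 - \<mu>\<close>, only a power series
  in \<open>\<rho>\<close> is left of the product of the Legendre functions.
\<close>

definition legendre_ext :: "real \<Rightarrow> complex \<Rightarrow> complex \<Rightarrow> real \<Rightarrow> complex" where
  "legendre_ext \<mu> l \<rho> x =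
     of_real (2 powr (1 / 2 - \<mu>) / (Gamma (\<mu> + 1 / 2))\<^sup>2 * (1 - x\<^sup>2) powr (\<mu> / 2 - 1 / 4)) *
     eval_fps (brafman \<mu> l x) \<rho>"

lemma analytic_legendre_ext:
  assumes \<mu>: "\<mu> > - 1 / 2" "\<mu> \<noteq> 0" and x: "-1 < x" "x < 1"
  shows "(\<lambda>\<rho>. legendre_ext \<mu> l \<rho> x) analytic_on ball 0 1"
proof -
  have "ball 0 1 \<subseteq> eball (0 :: complex) (fps_conv_radius (brafman \<mu> l x))"
  proof
    fix z :: complex assume "z \<in> ball 0 1"
    hence "ereal (norm z) < 1" by simp
    also have "1 \<le> fps_conv_radius (brafman \<mu> l x)" using x by (intro fps_conv_radius_brafman \<mu>) auto
    finally show "z \<in> eball 0 (fps_conv_radius (brafman \<mu> l x))" by (simp add: in_eball_iff)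
  qed
  thus ?thesis unfolding legendre_ext_def by (intro analytic_intros analytic_on_eval_fps) auto
qed

lemma legendre_ext_of_real:
  assumes \<mu>: "\<mu> > - 1 / 2" "\<mu> \<noteq> 0" and x: "-1 < x" "x < 1" and \<rho>: "0 < \<rho>" "\<rho> < 1"
  shows "legendre_ext \<mu> l (of_real \<rho>) x = of_real (\<rho> powr (1 / 2 - \<mu>)) * legendre_ferrers \<mu> l \<rho> x"
proof -
  have "\<rho> powr (1 / 2 - \<mu>) * (\<rho> / 2) powr (\<mu> - 1 / 2) = 2 powr (1 / 2 - \<mu>)"
  proof -
    have "(\<rho> / 2) powr (\<mu> - 1 / 2) = \<rho> powr (\<mu> - 1 / 2) * 2 powr (1 / 2 - \<mu>)"
      using \<rho> powr_minus_divide[of 2 "\<mu> - 1 / 2"] by (simp add: powr_divide)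
    moreover have "\<rho> powr (1 / 2 - \<mu>) * \<rho> powr (\<mu> - 1 / 2) = 1" using \<rho> by (simp flip: powr_add)
    ultimately show ?thesis by (simp flip: mult.assoc)
  qed
  thus ?thesis
    unfolding legendre_ferrers_eq_brafman[OF assms] legendre_ext_def mult.assoc[symmetric] of_real_mult[symmetric]
    by (simp only: times_divide_eq_left times_divide_eq_right mult.assoc[symmetric])
qed

text \<open>
  The two half powers of \<open>1 - x^2\<close> combine to the Gegenbauer weight. The bound on the polynomials is
  uniform in \<open>x\<close>, so the series may be integrated term by term, and orthogonality leaves the term of
  degree \<open>n\<close>.
\<close>

lemma has_bochner_integral_legendre_ext:
  assumes \<mu>: "\<mu> > - 1 / 2" "\<mu> \<noteq> 0" and \<rho>: "norm \<rho> < 1"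
  shows "has_bochner_integral lborel
     (\<lambda>x. indicator {-1<..<1} x *\<^sub>R (complex_of_real ((1 - x\<^sup>2) powr (\<mu> / 2 - 1 / 4)) * legendre_ext \<mu> l \<rho> x *
          gegenbauer n (of_real \<mu>) (of_real x)))
     (pochhammer l n * pochhammer (2 * of_real \<mu> - l) n * \<rho> ^ n * of_real (2 powr (\<mu> - 1 / 2)) /
       of_real ((real n + \<mu>) * Gamma (2 * \<mu>) * pochhammer (\<mu> + 1 / 2) n * fact n))"
proof -
  define k where "k = 2 powr (1 / 2 - \<mu>) / (Gamma (\<mu> + 1 / 2))\<^sup>2"
  define h where "h = pochhammer (2 * \<mu>) n * 2 powr (2 * \<mu> - 1) * (Gamma (\<mu> + 1 / 2))\<^sup>2 /
        (fact n * (real n + \<mu>) * Gamma (2 * \<mu>))"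
  define d where "d = (\<lambda>m. of_real k * brafman_coeff \<mu> l m * \<rho> ^ m)"
  define f where "f = (\<lambda>m x. d m * complex_of_real (ultra_weight \<mu> x * (ultra \<mu> m x * ultra \<mu> n x)))"
  define w where "w = integral\<^sup>L lborel (ultra_weight \<mu>)"
  have orth: "has_bochner_integral lborel (f m) (d m * of_real (if m = n then h else 0))" for m
    unfolding f_def h_def
    by (intro has_bochner_integral_mult_right has_bochner_integral_of_real ultra_orthogonal \<mu>)
  have w_int: "integrable lborel (ultra_weight \<mu>)"
    using has_bochner_integral_ultra_weight[OF \<mu>(1), of 0 0] by (simp add: has_bochner_integral_iff)
  have w_nonneg: "ultra_weight \<mu> x \<ge> 0" for x by (simp add: ultra_weight_def)
  have f_le: "norm (f m x) \<le> norm (d m) * ultra_bound \<mu> m * ultra_bound \<mu> n * ultra_weight \<mu> x" for m x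
  proof (cases "x \<in> {-1<..<1}")
    case True
    have "\<bar>ultra \<mu> m x\<bar> * \<bar>ultra \<mu> n x\<bar> \<le> ultra_bound \<mu> m * ultra_bound \<mu> n"
      using True by (intro mult_mono abs_ultra_le \<mu>) (auto simp: ultra_bound_nonneg)
    hence "norm (d m) * (ultra_weight \<mu> x * (\<bar>ultra \<mu> m x\<bar> * \<bar>ultra \<mu> n x\<bar>)) \<le>
       norm (d m) * (ultra_weight \<mu> x * (ultra_bound \<mu> m * ultra_bound \<mu> n))"
      using w_nonneg[of x] by (intro mult_left_mono) auto
    thus ?thesis using w_nonneg[of x] by (simp add: f_def norm_mult abs_mult mult_ac)
  qed (simp add: f_def ultra_weight_def)
  have sm: "summable (\<lambda>m. norm (d m) * ultra_bound \<mu> m * ultra_bound \<mu> n * t)" for t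
  proof -
    have "summable (\<lambda>m. \<bar>k\<bar> * ultra_bound \<mu> n * t * (norm (brafman_coeff \<mu> l m) * ultra_bound \<mu> m * norm \<rho> ^ m))"
      using \<rho> by (intro summable_mult summable_brafman_bound) auto
    thus ?thesis by (simp add: d_def norm_mult norm_power mult_ac)
  qed
  have i: "integrable lborel (f m)" for m using orth[of m] by (simp add: has_bochner_integral_iff)
  have ae: "AE x in lborel. summable (\<lambda>m. norm (f m x))"
    using f_le by (intro AE_I2 summable_comparison_test'[OF sm, of 0]) auto
  have si: "summable (\<lambda>m. \<integral>x. norm (f m x) \<partial>lborel)"
  proof (rule summable_comparison_test'[OF sm[of w], of 0])
    fix m :: nat
    have "(\<integral>x. norm (f m x) \<partial>lborel) \<le> (\<integral>x. norm (d m) * ultra_bound \<mu> m * ultra_bound \<mu> n * ultra_weight \<mu> x \<partial>lborel)"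
      by (intro integral_mono f_le integrable_norm i integrable_mult_right w_int)
    thus "norm (\<integral>x. norm (f m x) \<partial>lborel) \<le> norm (d m) * ultra_bound \<mu> m * ultra_bound \<mu> n * w"
      by (simp add: w_def)
  qed
  have series: "(\<Sum>m. f m x) = indicator {-1<..<1} x *\<^sub>R (complex_of_real ((1 - x\<^sup>2) powr (\<mu> / 2 - 1 / 4)) *
       legendre_ext \<mu> l \<rho> x * gegenbauer n (of_real \<mu>) (of_real x))" for x
  proof (cases "x \<in> {-1<..<1}")
    case True
    define p where "p = (1 - x\<^sup>2) powr (\<mu> / 2 - 1 / 4)"
    have pp: "ultra_weight \<mu> x = p * p"
      using True by (simp add: ultra_weight_def p_def flip: powr_add)
    have lt: "ereal (norm \<rho>) < fps_conv_radius (brafman \<mu> l x)"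
      by (rule less_le_trans[OF _ fps_conv_radius_brafman[OF \<mu>]]) (use True \<rho> in auto)
    hence "(\<lambda>m. fps_nth (brafman \<mu> l x) m * \<rho> ^ m) sums eval_fps (brafman \<mu> l x) \<rho>"
      unfolding eval_fps_def by (intro summable_sums summable_fps)
    hence "(\<lambda>m. of_real (k * p * p * ultra \<mu> n x) * (fps_nth (brafman \<mu> l x) m * \<rho> ^ m)) sums
       (of_real (k * p * p * ultra \<mu> n x) * eval_fps (brafman \<mu> l x) \<rho>)"
      by (rule sums_mult)
    also have "(\<lambda>m. of_real (k * p * p * ultra \<mu> n x) * (fps_nth (brafman \<mu> l x) m * \<rho> ^ m)) = (\<lambda>m. f m x)"
      unfolding brafman_nth[OF \<mu>] f_def pp d_def by (simp add: fun_eq_iff mult_ac)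
    finally have "(\<Sum>m. f m x) = of_real (k * p * p * ultra \<mu> n x) * eval_fps (brafman \<mu> l x) \<rho>"
      by (simp add: sums_iff)
    thus ?thesis using True
      unfolding legendre_ext_def k_def[symmetric] p_def[symmetric] gegenbauer_eq_ultra by (simp add: mult_ac)
  qed (simp add: f_def ultra_weight_def)
  have "(\<lambda>m. integral\<^sup>L lborel (f m)) sums (d n * of_real h)"
  proof -
    have "integral\<^sup>L lborel (f m) = (if m = n then d n * of_real h else 0)" for m
      using has_bochner_integral_integral_eq[OF orth[of m]] by auto
    thus ?thesis using sums_single[of n "\<lambda>_. d n * of_real h"] by simp
  qed
  moreover have "(\<lambda>m. integral\<^sup>L lborel (f m)) sums (\<integral>x. (\<Sum>m. f m x) \<partial>lborel)"
    by (rule sums_integral[OF i ae si])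
  ultimately have "(\<integral>x. (\<Sum>m. f m x) \<partial>lborel) = d n * of_real h"
    by (blast intro: sums_unique2)
  moreover have "integrable lborel (\<lambda>x. \<Sum>m. f m x)"
    by (rule integrable_suminf[OF i ae si])
  moreover have "d n * of_real h = pochhammer l n * pochhammer (2 * of_real \<mu> - l) n * \<rho> ^ n * of_real (2 powr (\<mu> - 1 / 2)) /
       of_real ((real n + \<mu>) * Gamma (2 * \<mu>) * pochhammer (\<mu> + 1 / 2) n * fact n)"
  proof -
    define g q where "g = Gamma (\<mu> + 1 / 2)" and "q = pochhammer (2 * \<mu>) n"
    have "g > 0" unfolding g_def by (rule Gamma_real_pos) (use \<mu> in simp)
    hence g: "g \<noteq> 0" by simp
    have q: "q \<noteq> 0" unfolding q_def by (rule two_mu_pochhammer_neq_0[OF \<mu>])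
    have pw: "2 powr (1 / 2 - \<mu>) * 2 powr (2 * \<mu> - 1) = (2 powr (\<mu> - 1 / 2) :: real)"
      by (simp flip: powr_add)
    have "k * h = q * (2 powr (1 / 2 - \<mu>) * 2 powr (2 * \<mu> - 1)) / (fact n * (real n + \<mu>) * Gamma (2 * \<mu>))"
      using g by (simp add: k_def h_def g_def[symmetric] q_def[symmetric])
    hence kh: "k * h = q * 2 powr (\<mu> - 1 / 2) / (fact n * (real n + \<mu>) * Gamma (2 * \<mu>))"
      unfolding pw .
    have p: "pochhammer (of_real \<mu> + 1 / 2) n = complex_of_real (pochhammer (\<mu> + 1 / 2) n)"
      "pochhammer (2 * of_real \<mu>) n = complex_of_real q"
      using pochhammer_of_real[of "\<mu> + 1 / 2" n, where 'a = complex] pochhammer_of_real[of "2 * \<mu>" n, where 'a = complex]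
      by (simp_all add: q_def)
    have "d n * of_real h = brafman_coeff \<mu> l n * \<rho> ^ n * of_real (k * h)" by (simp add: d_def mult_ac)
    thus ?thesis unfolding kh brafman_coeff_def p using q by (simp add: mult_ac)
  qed
  ultimately show ?thesis unfolding series[symmetric] has_bochner_integral_iff by simp
qed

theorem mainTheorem19:
  fixes n :: nat and \<mu> :: real and l :: complex
  assumes "\<mu> > - 1 / 2" and "\<mu> \<noteq> 0"
  shows
    "(\<forall>\<rho>::real. 0 < \<rho> \<and> \<rho> < 1 \<longrightarrow>
        set_integrable lborel {-1<..<1}
          (\<lambda>x. complex_of_real ((1 - x\<^sup>2) powr (\<mu> / 2 - 1 / 4)) * legendre_ferrers \<mu> l \<rho> x *
               gegenbauer n (of_real \<mu>) (of_real x)) \<and>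
        (LINT x:{-1<..<1}|lborel.
            complex_of_real ((1 - x\<^sup>2) powr (\<mu> / 2 - 1 / 4)) * legendre_ferrers \<mu> l \<rho> x *
            gegenbauer n (of_real \<mu>) (of_real x)) =
        pochhammer l n * pochhammer (2 * of_real \<mu> - l) n *
        of_real (\<rho> powr (real n + \<mu> - 1 / 2) * 2 powr (\<mu> - 1 / 2)) /
        of_real ((real n + \<mu>) * Gamma (2 * \<mu>) * pochhammer (\<mu> + 1 / 2) n * fact n)) \<and>
     (\<exists>G :: complex \<Rightarrow> real \<Rightarrow> complex.
        (\<forall>x\<in>{-1<..<1}. (\<lambda>\<rho>. G \<rho> x) analytic_on ball 0 1 \<and>
           (\<forall>\<rho>\<in>{0<..<1::real}.
              G (of_real \<rho>) x = of_real (\<rho> powr (1 / 2 - \<mu>)) * legendre_ferrers \<mu> l \<rho> x)) \<and>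
        (\<forall>\<rho>\<in>ball 0 1.
           set_integrable lborel {-1<..<1}
             (\<lambda>x. complex_of_real ((1 - x\<^sup>2) powr (\<mu> / 2 - 1 / 4)) * G \<rho> x *
                  gegenbauer n (of_real \<mu>) (of_real x)) \<and>
           (LINT x:{-1<..<1}|lborel.
               complex_of_real ((1 - x\<^sup>2) powr (\<mu> / 2 - 1 / 4)) * G \<rho> x *
               gegenbauer n (of_real \<mu>) (of_real x)) =
           pochhammer l n * pochhammer (2 * of_real \<mu> - l) n *
           \<rho> ^ n * of_real (2 powr (\<mu> - 1 / 2)) /
           of_real ((real n + \<mu>) * Gamma (2 * \<mu>) * pochhammer (\<mu> + 1 / 2) n * fact n)))"
proof (intro conjI allI impI, goal_cases)
  case (3)
  show ?case
  proof (intro exI[of _ "legendre_ext \<mu> l"] conjI ballI)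
    fix \<rho> :: complex assume "\<rho> \<in> ball 0 1"
    hence "norm \<rho> < 1" by simp
    note I = has_bochner_integral_legendre_ext[OF assms this, of l n]
    from I show "set_integrable lborel {-1<..<1}
             (\<lambda>x. complex_of_real ((1 - x\<^sup>2) powr (\<mu> / 2 - 1 / 4)) * legendre_ext \<mu> l \<rho> x *
                  gegenbauer n (of_real \<mu>) (of_real x))"
      unfolding set_integrable_def by (simp only: has_bochner_integral_iff)
    from I show "(LINT x:{-1<..<1}|lborel.
               complex_of_real ((1 - x\<^sup>2) powr (\<mu> / 2 - 1 / 4)) * legendre_ext \<mu> l \<rho> x *
               gegenbauer n (of_real \<mu>) (of_real x)) =
           pochhammer l n * pochhammer (2 * of_real \<mu> - l) n *
           \<rho> ^ n * of_real (2 powr (\<mu> - 1 / 2)) /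
           of_real ((real n + \<mu>) * Gamma (2 * \<mu>) * pochhammer (\<mu> + 1 / 2) n * fact n)"
      unfolding set_lebesgue_integral_def by (simp only: has_bochner_integral_iff)
  qed (use assms in \<open>auto intro!: analytic_legendre_ext legendre_ext_of_real\<close>)
next
  \<comment> \<open>For real \<open>\<rho>\<close> the literal integrand is \<open>\<rho>\<close> to the power \<open>\<mu> - 1/2\<close> times the extended one.\<close>
  have key: "has_bochner_integral lborel
     (\<lambda>x. indicator {-1<..<1} x *\<^sub>R (complex_of_real ((1 - x\<^sup>2) powr (\<mu> / 2 - 1 / 4)) * legendre_ferrers \<mu> l \<rho> x *
          gegenbauer n (of_real \<mu>) (of_real x)))
     (pochhammer l n * pochhammer (2 * of_real \<mu> - l) n * of_real (\<rho> powr (real n + \<mu> - 1 / 2) * 2 powr (\<mu> - 1 / 2)) /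
       of_real ((real n + \<mu>) * Gamma (2 * \<mu>) * pochhammer (\<mu> + 1 / 2) n * fact n))"
    if \<rho>: "0 < \<rho> \<and> \<rho> < 1" for \<rho> :: real
  proof -
    define s where "s = \<rho> powr (\<mu> - 1 / 2)"
    have s: "s * \<rho> powr (1 / 2 - \<mu>) = 1" "s * \<rho> ^ n = \<rho> powr (real n + \<mu> - 1 / 2)"
      using \<rho> by (simp_all add: s_def algebra_simps flip: powr_add powr_realpow)
    have lf: "legendre_ferrers \<mu> l \<rho> x = of_real s * legendre_ext \<mu> l (of_real \<rho>) x" if "x \<in> {-1<..<1}" for x
    proof -
      have "of_real s * legendre_ext \<mu> l (of_real \<rho>) x = of_real (s * \<rho> powr (1 / 2 - \<mu>)) * legendre_ferrers \<mu> l \<rho> x"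
        using that \<rho> legendre_ext_of_real[OF assms, of x \<rho> l] by simp
      thus ?thesis by (simp add: s)
    qed
    have "norm (complex_of_real \<rho>) < 1" using \<rho> by simp
    note I = has_bochner_integral_legendre_ext[OF assms this, of l n]
    have "has_bochner_integral lborel
     (\<lambda>x. of_real s * (indicator {-1<..<1} x *\<^sub>R (complex_of_real ((1 - x\<^sup>2) powr (\<mu> / 2 - 1 / 4)) * legendre_ext \<mu> l (of_real \<rho>) x *
          gegenbauer n (of_real \<mu>) (of_real x))))
     (of_real s * (pochhammer l n * pochhammer (2 * of_real \<mu> - l) n * of_real \<rho> ^ n * of_real (2 powr (\<mu> - 1 / 2)) /
       of_real ((real n + \<mu>) * Gamma (2 * \<mu>) * pochhammer (\<mu> + 1 / 2) n * fact n)))"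
      by (rule has_bochner_integral_mult_right) (rule I)
    also have "(\<lambda>x. of_real s * (indicator {-1<..<1} x *\<^sub>R (complex_of_real ((1 - x\<^sup>2) powr (\<mu> / 2 - 1 / 4)) * legendre_ext \<mu> l (of_real \<rho>) x *
          gegenbauer n (of_real \<mu>) (of_real x)))) =
       (\<lambda>x. indicator {-1<..<1} x *\<^sub>R (complex_of_real ((1 - x\<^sup>2) powr (\<mu> / 2 - 1 / 4)) * legendre_ferrers \<mu> l \<rho> x *
          gegenbauer n (of_real \<mu>) (of_real x)))"
    proof
      fix x :: real
      show "of_real s * (indicator {-1<..<1} x *\<^sub>R (complex_of_real ((1 - x\<^sup>2) powr (\<mu> / 2 - 1 / 4)) * legendre_ext \<mu> l (of_real \<rho>) x *
          gegenbauer n (of_real \<mu>) (of_real x))) = indicator {-1<..<1} x *\<^sub>R (complex_of_real ((1 - x\<^sup>2) powr (\<mu> / 2 - 1 / 4)) * legendre_ferrers \<mu> l \<rho> x *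
          gegenbauer n (of_real \<mu>) (of_real x))"
        using lf[of x] by (cases "x \<in> {-1<..<1}") simp_all
    qed
    also have "of_real s * (pochhammer l n * pochhammer (2 * of_real \<mu> - l) n * of_real \<rho> ^ n * of_real (2 powr (\<mu> - 1 / 2)) /
       of_real ((real n + \<mu>) * Gamma (2 * \<mu>) * pochhammer (\<mu> + 1 / 2) n * fact n)) =
       pochhammer l n * pochhammer (2 * of_real \<mu> - l) n * of_real (\<rho> powr (real n + \<mu> - 1 / 2) * 2 powr (\<mu> - 1 / 2)) /
       of_real ((real n + \<mu>) * Gamma (2 * \<mu>) * pochhammer (\<mu> + 1 / 2) n * fact n)"
      unfolding s(2)[symmetric] by (simp add: mult_ac)
    finally show ?thesis .
  qed
  {
    case (1 \<rho>)
    show ?case using key[OF 1] unfolding set_integrable_def by (simp only: has_bochner_integral_iff)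
  next
    case (2 \<rho>)
    show ?case using key[OF 2] unfolding set_lebesgue_integral_def by (simp only: has_bochner_integral_iff)
  }
qed

end
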